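(* Let $L$ be a finite-dimensional solvable restricted Lie algebra over an algebraically closed field $\mathbb{F}$ of prime characteristic $p$, and let $\chi$ be a linear form on $L$. Then the number of isomorphism classes of irreducible $L$-modules with $p$-character $\chi$ is at most $p^{\mathrm{MT}(L)}$.
   Context: Let $(L,{}^{[p]})$ be a finite-dimensional restricted Lie algebra over a field $\mathbb{F}$ of prime characteristic $p$. For a linear form $\chi:L\to\mathbb{F}$, an $L$-module $M$ has $p$-character $\chi$ if $x^p\cdot m-x^{[p]}\cdot m=\chi(x)^p m$ for all $x\in L$, $m\in M$; equivalently, $M$ is a module over the $\chi$-reduced universal enveloping algebra $u(L,\chi):=U(L)/(x^p-x^{[p]}-\chi(x)^p\cdot 1\mid x\in L)$. A $p$-subalgebra is a subalgebra closed under the $[p]$-map. A torus of $L$ is an abelian $p$-subalgebra all of whose elements $x$ are semisimple, i.e. $x$ lies in the $p$-subalgebra generated by $x^{[p]}$. $\mathrm{MT}(L):=\max\{\dim_{\mathbb{F}}T\mid T\text{ is a torus of }L\}$. *)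

theory Defs
  imports "HOL-Computational_Algebra.Polynomial" "HOL-Computational_Algebra.Primes"
begin

locale lie_algebra = vector_space scale
  for scale :: "'f::field \<Rightarrow> 'l::ab_group_add \<Rightarrow> 'l" +
  fixes bracket :: "'l \<Rightarrow> 'l \<Rightarrow> 'l"
  assumes bracket_linear_right: "Vector_Spaces.linear scale scale (bracket x)"
    and bracket_linear_left: "Vector_Spaces.linear scale scale (\<lambda>x. bracket x y)"
    and bracket_self: "bracket x x = 0"
    and jacobi: "bracket x (bracket y z) + bracket y (bracket z x) + bracket z (bracket x y) = 0"
begin

definition derived_subalgebra :: "'l set \<Rightarrow> 'l set" where
  "derived_subalgebra S = span {bracket x y | x y. x \<in> S \<and> y \<in> S}"

definition solvable :: bool where
  "solvable \<longleftrightarrow> (\<exists>n. (derived_subalgebra ^^ n) UNIV = {0})"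

text \<open>
  The elements of \<open>L \<otimes> F[t]\<close> are represented by the type \<open>'l poly\<close>; \<open>ad_poly x y\<close> is the
  operator \<open>ad (x \<otimes> t + y \<otimes> 1)\<close> on it.
\<close>

definition ad_poly :: "'l \<Rightarrow> 'l \<Rightarrow> 'l poly \<Rightarrow> 'l poly" where
  "ad_poly x y q = pCons 0 (map_poly (bracket x) q) + map_poly (bracket y) q"

text \<open>
  Jacobson's \<open>s_i (x, y)\<close>, given for \<open>0 < i < p\<close> by
  \<open>(ad (x \<otimes> t + y \<otimes> 1))^(p-1) (x \<otimes> 1) = (\<Sum>i=1..p-1. i s_i (x, y) \<otimes> t^(i-1))\<close>.
\<close>

definition jacobson_s :: "nat \<Rightarrow> nat \<Rightarrow> 'l \<Rightarrow> 'l \<Rightarrow> 'l" where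
  "jacobson_s p i x y =
     scale (inverse (of_nat i)) (coeff ((ad_poly x y ^^ (p - 1)) [:x:]) (i - 1))"

end

locale restricted_lie_algebra = lie_algebra scale bracket
  for scale :: "'f::field \<Rightarrow> 'l::ab_group_add \<Rightarrow> 'l"
    and bracket :: "'l \<Rightarrow> 'l \<Rightarrow> 'l" +
  fixes p :: nat
    and pmap :: "'l \<Rightarrow> 'l"
  assumes prime_p: "prime p"
    and char_p: "CHAR('f) = p"
    and ad_pmap: "bracket (pmap x) y = (bracket x ^^ p) y"
    and pmap_scale: "pmap (scale a x) = scale (a ^ p) (pmap x)"
    and pmap_add: "pmap (x + y) = pmap x + pmap y + (\<Sum>i=1..p-1. jacobson_s p i x y)"
begin

definition p_subalgebra :: "'l set \<Rightarrow> bool" where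
  "p_subalgebra S \<longleftrightarrow>
     subspace S \<and> (\<forall>x\<in>S. \<forall>y\<in>S. bracket x y \<in> S) \<and> (\<forall>x\<in>S. pmap x \<in> S)"

definition semisimple :: "'l \<Rightarrow> bool" where
  "semisimple x \<longleftrightarrow> x \<in> p_subalgebra hull {pmap x}"

definition torus :: "'l set \<Rightarrow> bool" where
  "torus T \<longleftrightarrow>
     p_subalgebra T \<and> (\<forall>x\<in>T. \<forall>y\<in>T. bracket x y = 0) \<and> (\<forall>x\<in>T. semisimple x)"

definition MT :: nat where
  "MT = Max {dim T | T. torus T}"

lemma pmap_0: "pmap 0 = 0"
  using pmap_scale[of 0 0] prime_gt_0_nat[OF prime_p] by (simp add: power_0_left)

lemma torus_0: "torus {0}"
proof -
  have "bracket 0 0 = 0"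
    by (rule bracket_self)
  then show ?thesis
    by (auto simp: torus_def p_subalgebra_def semisimple_def pmap_0 subspace_def hull_def)
qed

text \<open>In finite dimension the maximum in \<^const>\<open>MT\<close> is over a finite nonempty set.\<close>

lemma torus_dims:
  assumes "finite_dimensional_vector_space scale B"
  shows "finite {dim T | T. torus T}" and "{dim T | T. torus T} \<noteq> {}"
proof -
  interpret fd: finite_dimensional_vector_space scale B
    by (rule assms)
  have "{dim T | T. torus T} \<subseteq> {..dim UNIV}"
    using fd.dim_subset_UNIV by (auto simp: fd.dimension_def)
  then show "finite {dim T | T. torus T}"
    using finite_subset by blast
qed (use torus_0 in auto)

end

text \<open>
  A module is a pair \<open>(M, act)\<close> of a subspace \<open>M\<close> of an arbitrary ambient vector space, with
  scalar multiplication \<open>scaleV\<close>, and an action of \<open>L\<close> on \<open>M\<close>; the values of \<open>act x\<close> outside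
  \<open>M\<close> are irrelevant. Neither \<open>M\<close> nor the ambient space is assumed to be finite-dimensional.
  Modules over different vector spaces can be compared within one type in this way: any
  set of modules embeds into its direct sum.
\<close>

locale restricted_lie_algebra_rep =
  L: restricted_lie_algebra scale bracket p pmap + V: vector_space scaleV
  for scale :: "'f::field \<Rightarrow> 'l::ab_group_add \<Rightarrow> 'l"
    and bracket :: "'l \<Rightarrow> 'l \<Rightarrow> 'l"
    and p :: nat
    and pmap :: "'l \<Rightarrow> 'l"
    and scaleV :: "'f \<Rightarrow> 'v::ab_group_add \<Rightarrow> 'v"
begin

definition lie_module :: "'v set \<Rightarrow> ('l \<Rightarrow> 'v \<Rightarrow> 'v) \<Rightarrow> bool" where
  "lie_module M act \<longleftrightarrow>
     V.subspace M \<and>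
     (\<forall>x. \<forall>m\<in>M. act x m \<in> M) \<and>
     (\<forall>x. \<forall>m\<in>M. \<forall>n\<in>M. act x (m + n) = act x m + act x n) \<and>
     (\<forall>x a. \<forall>m\<in>M. act x (scaleV a m) = scaleV a (act x m)) \<and>
     (\<forall>x y. \<forall>m\<in>M. act (x + y) m = act x m + act y m) \<and>
     (\<forall>x a. \<forall>m\<in>M. act (scale a x) m = scaleV a (act x m)) \<and>
     (\<forall>x y. \<forall>m\<in>M. act (bracket x y) m = act x (act y m) - act y (act x m))"

definition has_p_character :: "'v set \<Rightarrow> ('l \<Rightarrow> 'v \<Rightarrow> 'v) \<Rightarrow> ('l \<Rightarrow> 'f) \<Rightarrow> bool" where
  "has_p_character M act \<chi> \<longleftrightarrow>
     (\<forall>x. \<forall>m\<in>M. (act x ^^ p) m - act (pmap x) m = scaleV (\<chi> x ^ p) m)"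

definition irreducible_module :: "'v set \<Rightarrow> ('l \<Rightarrow> 'v \<Rightarrow> 'v) \<Rightarrow> bool" where
  "irreducible_module M act \<longleftrightarrow>
     lie_module M act \<and> M \<noteq> {0} \<and>
     (\<forall>N. N \<subseteq> M \<and> lie_module N act \<longrightarrow> N = {0} \<or> N = M)"

definition irreducible_modules :: "('l \<Rightarrow> 'f) \<Rightarrow> ('v set \<times> ('l \<Rightarrow> 'v \<Rightarrow> 'v)) set" where
  "irreducible_modules \<chi> =
     {(M, act). irreducible_module M act \<and> has_p_character M act \<chi>}"

definition isomorphic ::
    "'v set \<times> ('l \<Rightarrow> 'v \<Rightarrow> 'v) \<Rightarrow> 'v set \<times> ('l \<Rightarrow> 'v \<Rightarrow> 'v) \<Rightarrow> bool" where
  "isomorphic = (\<lambda>(M, act) (N, act').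
     \<exists>f. bij_betw f M N \<and>
         (\<forall>m\<in>M. \<forall>n\<in>M. f (m + n) = f m + f n) \<and>
         (\<forall>a. \<forall>m\<in>M. f (scaleV a m) = scaleV a (f m)) \<and>
         (\<forall>x. \<forall>m\<in>M. f (act x m) = act' x (f m)))"

definition iso_rel :: "('l \<Rightarrow> 'f) \<Rightarrow>
    (('v set \<times> ('l \<Rightarrow> 'v \<Rightarrow> 'v)) \<times> ('v set \<times> ('l \<Rightarrow> 'v \<Rightarrow> 'v))) set" where
  "iso_rel \<chi> =
     {(X, Y). X \<in> irreducible_modules \<chi> \<and> Y \<in> irreducible_modules \<chi> \<and> isomorphic X Y}"

definition irreducible_classes :: "('l \<Rightarrow> 'f) \<Rightarrow> ('v set \<times> ('l \<Rightarrow> 'v \<Rightarrow> 'v)) set set" where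
  "irreducible_classes \<chi> = irreducible_modules \<chi> // iso_rel \<chi>"

lemma isomorphic_refl: "isomorphic X X"
  by (auto simp: isomorphic_def split: prod.split intro!: exI[of _ id])

lemma isomorphic_sym:
  assumes "lie_module (fst X) (snd X)" "isomorphic X Y"
  shows "isomorphic Y X"
proof -
  obtain M act N act' where XY: "X = (M, act)" "Y = (N, act')"
    by (meson surj_pair)
  obtain f where f: "bij_betw f M N"
    and add: "\<And>m n. m \<in> M \<Longrightarrow> n \<in> M \<Longrightarrow> f (m + n) = f m + f n"
    and scl: "\<And>a m. m \<in> M \<Longrightarrow> f (scaleV a m) = scaleV a (f m)"
    and equi: "\<And>x m. m \<in> M \<Longrightarrow> f (act x m) = act' x (f m)"
    using assms(2) by (auto simp: isomorphic_def XY)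
  have sub: "V.subspace M" and act: "\<And>x m. m \<in> M \<Longrightarrow> act x m \<in> M"
    using assms(1) by (auto simp: lie_module_def XY)
  define g where "g = inv_into M f"
  have g: "bij_betw g N M" "\<And>n. n \<in> N \<Longrightarrow> f (g n) = n" "\<And>m. m \<in> M \<Longrightarrow> g (f m) = m"
    using f by (auto simp: g_def bij_betw_inv_into bij_betw_inv_into_right bij_betw_inv_into_left)
  have gM: "g n \<in> M" if "n \<in> N" for n
    using g(1) that by (auto simp: bij_betw_def)
  have "g (m + n) = g m + g n" if "m \<in> N" "n \<in> N" for m n
    using g(3)[OF V.subspace_add[OF sub gM[OF that(1)] gM[OF that(2)]]] that
    by (simp add: add gM g(2))
  moreover have "g (scaleV a n) = scaleV a (g n)" if "n \<in> N" for a n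
    using g(3)[OF V.subspace_scale[OF sub gM[OF that]]] that by (simp add: scl gM g(2))
  moreover have "g (act' x n) = act x (g n)" if "n \<in> N" for x n
    using g(3)[OF act[OF gM[OF that]]] that by (simp add: equi gM g(2))
  ultimately show ?thesis
    using g(1) by (auto simp: isomorphic_def XY intro!: exI[of _ g])
qed

lemma isomorphic_trans:
  assumes "isomorphic X Y" "isomorphic Y Z"
  shows "isomorphic X Z"
proof -
  obtain M a N b P c where XYZ: "X = (M, a)" "Y = (N, b)" "Z = (P, c)"
    by (meson surj_pair)
  obtain f g where f: "bij_betw f M N" "\<forall>m\<in>M. \<forall>n\<in>M. f (m + n) = f m + f n"
      "\<forall>k. \<forall>m\<in>M. f (scaleV k m) = scaleV k (f m)" "\<forall>x. \<forall>m\<in>M. f (a x m) = b x (f m)"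
    and g: "bij_betw g N P" "\<forall>m\<in>N. \<forall>n\<in>N. g (m + n) = g m + g n"
      "\<forall>k. \<forall>m\<in>N. g (scaleV k m) = scaleV k (g m)" "\<forall>x. \<forall>m\<in>N. g (b x m) = c x (g m)"
    using assms by (auto simp: isomorphic_def XYZ)
  have "f m \<in> N" if "m \<in> M" for m
    using f(1) that by (auto simp: bij_betw_def)
  then show ?thesis
    using f(2-) g(2-) bij_betw_trans[OF f(1) g(1)]
    unfolding isomorphic_def XYZ prod.case by (intro exI[of _ "g \<circ> f"]) simp
qed

lemma equiv_iso_rel: "equiv (irreducible_modules \<chi>) (iso_rel \<chi>)"
proof (rule equivI)
  show "iso_rel \<chi> \<subseteq> irreducible_modules \<chi> \<times> irreducible_modules \<chi>"
    by (auto simp: iso_rel_def)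
  show "refl_on (irreducible_modules \<chi>) (iso_rel \<chi>)"
    by (auto simp: refl_on_def iso_rel_def isomorphic_refl)
  have "lie_module (fst X) (snd X)" if "X \<in> irreducible_modules \<chi>" for X
    using that by (simp add: irreducible_modules_def irreducible_module_def split: prod.splits)
  then show "sym (iso_rel \<chi>)"
    by (intro symI) (simp add: iso_rel_def isomorphic_sym)
  show "trans (iso_rel \<chi>)"
    unfolding iso_rel_def
    by (intro transI CollectI case_prodI conjI) (auto elim: isomorphic_trans)
qed

end

end

theory Submission
  imports Defs "HOL-Library.Function_Algebras"
begin

text \<open>
  The proof is a Clifford-style induction along a chain of \<open>p\<close>-ideals of codimension one. Solvability
  and algebraic closedness give, in every \<open>p\<close>-subalgebra \<open>H \<noteq> 0\<close>, an ideal \<open>K\<close> with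
  \<open>H = K + F z\<close>, \<open>[H, H] \<subseteq> K\<close> and \<open>z^[p] - \<epsilon> z \<in> K\<close> for some \<open>\<epsilon> \<in> {0, 1}\<close>.

  If \<open>S \<subseteq> M\<close> is a simple \<open>K\<close>-submodule of a simple \<open>H\<close>-module, then all \<open>K\<close>-composition factors
  of \<open>M\<close> are copies of \<open>S\<close>, so \<open>S\<close> is also a quotient of \<open>M\<close>. Hence two simple
  \<open>H\<close>-modules \<open>M\<close>, \<open>N\<close> over the same \<open>S\<close> satisfy \<open>Hom_K(M, N) \<noteq> 0\<close>. On this space \<open>z\<close> acts by
  an operator \<open>D\<close> with \<open>D^p = \<epsilon> D\<close>. An eigenvector of \<open>D\<close> is an isomorphism from \<open>M\<close>
  to \<open>N\<close> up to a twist by its eigenvalue \<open>c\<close>, and \<open>c^p = \<epsilon> c\<close>. So at most one simple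
  \<open>H\<close>-module lies over \<open>S\<close> if \<open>\<epsilon> = 0\<close>, and at most \<open>p\<close> if \<open>\<epsilon> = 1\<close>.

  In the case \<open>\<epsilon> = 1\<close> a torus of \<open>K\<close> with a basis of toral elements extends by a toral element
  outside \<open>K\<close>: correct \<open>z\<close> to commute with the torus, and then solve \<open>u - u^[p] = w\<close> as in
  Lang's theorem. Thus the number of steps with \<open>\<epsilon> = 1\<close> is at most \<open>MT\<close>.
\<close>

section \<open>Semilinear maps over algebraically closed fields\<close>

text \<open>
  The values \<open>e k\<close> of these polynomials at \<open>b\<close> satisfy \<open>e (k + 1) = e k ^ p + c k * b ^ p\<close>. If
  \<open>b = e n\<close> and \<open>f\<close> is semilinear with \<open>f^n w = (\<Sum>k<n. c k * f^k w)\<close>, then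
  \<open>u = (\<Sum>k<n. e (k + 1) * f^k w)\<close> telescopes to a solution of \<open>u - f u = s^p * w\<close>.
\<close>

primrec frob_poly :: "nat \<Rightarrow> (nat \<Rightarrow> 'f::comm_ring_1) \<Rightarrow> 'f \<Rightarrow> nat \<Rightarrow> 'f poly" where
  "frob_poly p c s 0 = [:s:]"
| "frob_poly p c s (Suc k) = frob_poly p c s k ^ p + monom (c k) p"

text \<open>Only p-th powers enter the construction, so the result is a polynomial in X^p. In the
  fixed point equation this makes \<open>frob_poly\<close> minus X have derivative -1.\<close>

lemma pderiv_frob_poly:
  fixes c :: "nat \<Rightarrow> 'f::field"
  assumes "CHAR('f) = p"
  shows "pderiv (frob_poly p c s k) = 0"
proof (cases k)
  case (Suc n)
  have "of_nat p = (0 :: 'f)"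
    using assms of_nat_CHAR by metis
  then show ?thesis
    by (simp add: Suc pderiv_add pderiv_power pderiv_monom)
qed (simp add: pderiv_pCons)

text \<open>The first nonzero \<open>c j\<close> creates a term of degree p. From then on every p-th
  power raises the degree above p, so the next summand \<open>c k\<close> X^p cannot cancel the
  leading term.\<close>

lemma frob_poly_nonzero_degree:
  fixes c :: "nat \<Rightarrow> 'f::field"
  assumes "p \<ge> 2" "\<exists>j<k. c j \<noteq> 0"
  shows "degree (frob_poly p c 0 k) \<ge> p"
  using assms(2)
proof (induction k)
  case (Suc k)
  show ?case
  proof (cases "\<exists>j<k. c j \<noteq> 0")
    case True
    then have ge: "degree (frob_poly p c 0 k) \<ge> p"
      by (rule Suc.IH)
    have "p * 1 < p * degree (frob_poly p c 0 k)"
      using ge assms(1) by (intro mult_strict_left_mono) auto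
    moreover have "frob_poly p c 0 k \<noteq> 0"
      using ge assms(1) by auto
    ultimately have lt: "p < degree (frob_poly p c 0 k ^ p)"
      by (simp add: degree_power_eq)
    then have "degree (monom (c k) p) < degree (frob_poly p c 0 k ^ p)"
      using degree_monom_le[of "c k" p] by simp
    then have "degree (frob_poly p c 0 (Suc k)) = degree (frob_poly p c 0 k ^ p)"
      by (simp add: degree_add_eq_left)
    then show ?thesis
      using lt by simp
  next
    case False
    then have z: "c j = 0" if "j < k" for j
      using that by blast
    have "frob_poly p c 0 j = 0" if "j \<le> k" for j
      using that by (induction j) (use z assms(1) in \<open>auto simp: power_0_left\<close>)
    moreover have "c k \<noteq> 0"
      using Suc.prems z by (metis less_antisym)
    ultimately show ?thesis
      using assms(1) by (simp add: power_0_left degree_monom_eq)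
  qed
qed simp

text \<open>In general \<open>frob_poly\<close> minus X has derivative -1, so it is not constant and
  has a root. For s = 0 the trivial fixed point 0 is of no use; a nonzero one appears after dividing
  by X.\<close>

lemma frob_poly_fixed_point:
  fixes c :: "nat \<Rightarrow> 'f::alg_closed_field"
  assumes "prime p" "CHAR('f) = p"
  shows "\<exists>b. poly (frob_poly p c s n) b = b \<and> (s = 0 \<and> (\<exists>k<n. c k \<noteq> 0) \<longrightarrow> b \<noteq> 0)"
proof (cases "s = 0 \<and> (\<exists>k<n. c k \<noteq> 0)")
  case True
  have p2: "p \<ge> 2"
    using assms(1) by (rule prime_ge_2_nat)
  define A where "A = frob_poly p c 0 n"
  have deg: "degree A \<ge> p"
    unfolding A_def using True p2 by (intro frob_poly_nonzero_degree) auto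
  have "poly (frob_poly p c 0 k) 0 = 0" for k
    using p2 by (induction k) (auto simp: poly_monom power_0_left)
  then have "poly A 0 = 0"
    by (simp add: A_def)
  \<comment> \<open>The fixed points of \<open>A\<close> other than 0 are the roots of
    \<open>B\<close> - 1. Since \<open>A\<close> has no linear term, \<open>B\<close> vanishes at 0,
    so no such root is 0.\<close>
  then obtain B where B: "A = [:0, 1:] * B"
    by (auto simp: poly_eq_0_iff_dvd elim: dvdE)
  have "coeff (pderiv A) 0 = 0"
    using pderiv_frob_poly[OF assms(2)] by (simp add: A_def)
  then have B0: "poly B 0 = 0"
    by (simp add: B coeff_pderiv poly_0_coeff_0)
  have "B \<noteq> 0"
    using deg p2 B by auto
  then have "degree A = Suc (degree B)"
    by (simp add: B)
  then have "degree (B + [:- 1:]) > 0"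
    using deg p2 by (simp add: degree_add_eq_left)
  then obtain b where "poly (B + [:- 1:]) b = 0"
    using alg_closed_imp_poly_has_root by blast
  then have b: "poly B b = 1"
    by simp
  then have "b \<noteq> 0"
    using B0 by auto
  moreover have "poly A b = b"
    by (simp add: B b)
  ultimately show ?thesis
    using True by (auto simp: A_def)
next
  case False
  define Q where "Q = frob_poly p c s n - [:0, 1:]"
  have "pderiv Q = [:- 1:]"
    by (simp add: pderiv_frob_poly[OF assms(2)] Q_def pderiv_diff pderiv_pCons)
  then have "degree Q > 0"
    by (cases "degree Q = 0") (auto elim: degree_eq_zeroE simp: pderiv_pCons)
  then obtain b where "poly Q b = 0"
    using alg_closed_imp_poly_has_root by blast
  then show ?thesis
    using False by (auto simp: Q_def)
qed

text \<open>The recursion refers forward to its own term \<open>e n\<close>. A fixed point b of the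
  n-th polynomial resolves this, because evaluating all polynomials at b gives
  \<open>e n = b\<close>.\<close>

lemma exists_frob_sequence:
  fixes c :: "nat \<Rightarrow> 'f::alg_closed_field"
  assumes "prime p" "CHAR('f) = p"
  obtains e where "e 0 = s" "\<And>k. e (Suc k) = e k ^ p + c k * e n ^ p"
    "s = 0 \<Longrightarrow> \<exists>k<n. c k \<noteq> 0 \<Longrightarrow> e n \<noteq> 0"
proof -
  obtain b where b: "poly (frob_poly p c s n) b = b" "s = 0 \<and> (\<exists>k<n. c k \<noteq> 0) \<longrightarrow> b \<noteq> 0"
    using frob_poly_fixed_point[OF assms] by metis
  show ?thesis
    by (rule that[of "\<lambda>k. poly (frob_poly p c s k) b"]) (use b in \<open>auto simp: poly_monom\<close>)
qed

lemma ex_root_power: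
  fixes a :: "'f::alg_closed_field"
  assumes "n > 0"
  obtains x where "x ^ n = a"
proof -
  have "degree (monom 1 n + [:- a:]) > 0"
    using assms by (simp add: degree_add_eq_left degree_monom_eq)
  then obtain x where "poly (monom 1 n + [:- a:]) x = 0"
    using alg_closed_imp_poly_has_root by blast
  then show ?thesis
    using that by (simp add: poly_monom)
qed

section \<open>Semilinear maps modulo a subspace, and relations between iterates\<close>

lemma (in vector_space) semilinear_iterate_sum:
  fixes f :: "'b \<Rightarrow> 'b"
  assumes K: "subspace K" and V: "subspace V" and fV: "\<And>v. v \<in> V \<Longrightarrow> f v \<in> V"
    and add: "\<And>x y. x \<in> V \<Longrightarrow> y \<in> V \<Longrightarrow> f (x + y) - (f x + f y) \<in> K"
    and scl: "\<And>a x. x \<in> V \<Longrightarrow> f (scale a x) = scale (a ^ p) (f x)" and "p > 0"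
    and w: "w \<in> V"
  shows "f (\<Sum>k<m. scale (a k) ((f ^^ k) w)) - (\<Sum>k<m. scale (a k ^ p) ((f ^^ Suc k) w)) \<in> K"
proof (induction m)
  case 0
  have "f 0 = 0"
    using scl[OF subspace_0[OF V], of 0] \<open>p > 0\<close> by (simp add: power_0_left)
  then show ?case
    using subspace_0[OF K] by simp
next
  case (Suc m)
  have wk: "(f ^^ k) w \<in> V" for k
    by (induction k) (auto simp: w fV)
  have "(\<Sum>k<m. scale (a k) ((f ^^ k) w)) \<in> V"
    by (intro subspace_sum V subspace_scale wk)
  from subspace_add[OF K add[OF this subspace_scale[OF V wk], of "a m" m] Suc] show ?case
    by (simp add: scl wk algebra_simps)
qed

text \<open>For s = 0 the vector u is fixed by f modulo \<open>K\<close>; for s = 1 it solves the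
  Artin-Schreier equation u - f u = w modulo \<open>K\<close>. Both cases are used.\<close>

lemma (in vector_space) semilinear_artin_schreier:
  fixes f :: "'b \<Rightarrow> 'b"
  assumes K: "subspace K" and V: "subspace V" and fV: "\<And>v. v \<in> V \<Longrightarrow> f v \<in> V"
    and add: "\<And>x y. x \<in> V \<Longrightarrow> y \<in> V \<Longrightarrow> f (x + y) - (f x + f y) \<in> K"
    and scl: "\<And>a x. x \<in> V \<Longrightarrow> f (scale a x) = scale (a ^ p) (f x)" and "p > 0"
    and w: "w \<in> V"
    and rel: "(f ^^ n) w - (\<Sum>k<n. scale (c k) ((f ^^ k) w)) \<in> K"
    and e: "e 0 = s" "\<And>k. e (Suc k) = e k ^ p + c k * e n ^ p"
  defines "u \<equiv> (\<Sum>k<n. scale (e (Suc k)) ((f ^^ k) w))"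
  shows "u \<in> V" "u - (scale (s ^ p) w + f u) \<in> K"
proof -
  have wk: "(f ^^ k) w \<in> V" for k
    by (induction k) (auto simp: w fV)
  have inV: "(\<Sum>k<m. scale (a k) ((f ^^ k) w)) \<in> V" for a m
    by (intro subspace_sum V subspace_scale wk)
  show "u \<in> V"
    unfolding u_def by (rule inV)
  \<comment> \<open>The recursion splits each \<open>e (Suc k)\<close>. The parts with factor
    \<open>e n ^ p\<close> form a multiple of the relation for the n-th iterate; the other parts,
    shifted by one index, are f u up to \<open>K\<close>, plus the term for k = 0.\<close>
  have "u = (\<Sum>k<n. scale (e k ^ p) ((f ^^ k) w)) + scale (e n ^ p) (\<Sum>k<n. scale (c k) ((f ^^ k) w))"
    by (simp add: u_def e scale_left_distrib sum.distrib scale_sum_right mult.commute)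
  also have "\<dots> = (\<Sum>k<Suc n. scale (e k ^ p) ((f ^^ k) w))
      - scale (e n ^ p) ((f ^^ n) w - (\<Sum>k<n. scale (c k) ((f ^^ k) w)))"
    by (simp add: scale_right_diff_distrib)
  also have "(\<Sum>k<Suc n. scale (e k ^ p) ((f ^^ k) w))
      = scale (s ^ p) w + (\<Sum>k<n. scale (e (Suc k) ^ p) ((f ^^ Suc k) w))"
    by (simp only: sum.lessThan_Suc_shift e(1)) simp
  finally have "u - (scale (s ^ p) w + f u) =
      - (f u - (\<Sum>k<n. scale (e (Suc k) ^ p) ((f ^^ Suc k) w)))
      - scale (e n ^ p) ((f ^^ n) w - (\<Sum>k<n. scale (c k) ((f ^^ k) w)))"
    by (simp add: algebra_simps)
  also have "\<dots> \<in> K"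
    using semilinear_iterate_sum[where V = V and f = f, OF K V fV add scl \<open>p > 0\<close> w, of "\<lambda>k. e (Suc k)" n]
    unfolding u_def
    by (rule subspace_diff[OF K subspace_neg[OF K] subspace_scale[OF K rel]])
  finally show "u - (scale (s ^ p) w + f u) \<in> K" .
qed

text \<open>If no iterate were a combination of its predecessors modulo \<open>K\<close>, the
  iterates would be distinct and linearly independent, so there would be more of them than the
  dimension allows. This works for an arbitrary map f.\<close>

lemma (in finite_dimensional_vector_space) ex_iterate_relation:
  assumes "subspace K"
  shows "\<exists>n c. (f ^^ n) w - (\<Sum>k<n. scale (c k) ((f ^^ k) w)) \<in> K"
proof (rule ccontr)
  assume none: "\<not> ?thesis"
  have new: "(f ^^ n) w \<notin> span ((\<lambda>k. (f ^^ k) w) ` {..<n})"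
    and inj: "inj_on (\<lambda>k. (f ^^ k) w) {..<n}" for n
  proof -
    have lt: "(f ^^ j) w \<noteq> (f ^^ i) w" if "i < j" for i j
    proof
      assume eq: "(f ^^ j) w = (f ^^ i) w"
      have "(\<Sum>k<j. scale (if k = i then 1 else 0) ((f ^^ k) w)) = (\<Sum>k<j. if k = i then (f ^^ k) w else 0)"
        by (intro sum.cong) auto
      also have "\<dots> = (f ^^ i) w"
        using that by (simp add: sum.delta)
      finally have "(f ^^ j) w - (\<Sum>k<j. scale (if k = i then 1 else 0) ((f ^^ k) w)) \<in> K"
        using eq subspace_0[OF assms] by simp
      then show False
        by (rule notE[OF none, OF exI[of _ j], OF exI[of _ "\<lambda>k. if k = i then 1 else 0"]])
    qed
    then show inj: "inj_on (\<lambda>k. (f ^^ k) w) {..<n}"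
      by (metis linorder_inj_onI' lessThan_iff)
    show "(f ^^ n) w \<notin> span ((\<lambda>k. (f ^^ k) w) ` {..<n})"
    proof
      assume "(f ^^ n) w \<in> span ((\<lambda>k. (f ^^ k) w) ` {..<n})"
      then obtain u where "(f ^^ n) w = (\<Sum>v\<in>(\<lambda>k. (f ^^ k) w) ` {..<n}. scale (u v) v)"
        by (auto simp: span_finite)
      then have "(f ^^ n) w - (\<Sum>k<n. scale (u ((f ^^ k) w)) ((f ^^ k) w)) \<in> K"
        using subspace_0[OF assms] by (simp add: sum.reindex[OF inj])
      then show False
        by (rule notE[OF none, OF exI[of _ n], OF exI[of _ "\<lambda>k. u ((f ^^ k) w)"]])
    qed
  qed
  have "independent ((\<lambda>k. (f ^^ k) w) ` {..<n})" for n
  proof (induction n)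
    case (Suc n)
    then show ?case
      using new[of n] by (simp add: lessThan_Suc independent_insertI)
  qed (simp add: independent_empty)
  then have "card ((\<lambda>k. (f ^^ k) w) ` {..<n}) \<le> dim UNIV" for n
    by (intro independent_card_le_dim) auto
  then have "n \<le> dim UNIV" for n
    using card_image[OF inj[of n]] by (metis card_lessThan)
  from this[of "Suc (dim UNIV)"] show False
    by simp
qed

section \<open>Ideals of codimension one and toral elements\<close>

context lie_algebra
begin

lemma bracket_add_right: "bracket x (y + z) = bracket x y + bracket x z"
  and bracket_scale_right: "bracket x (scale a y) = scale a (bracket x y)"
  and bracket_add_left: "bracket (x + y) z = bracket x z + bracket y z"
  and bracket_scale_left: "bracket (scale a x) z = scale a (bracket x z)"
  using bracket_linear_right[of x] bracket_linear_left[of z]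
  by (simp_all add: Vector_Spaces.linear_iff)

lemma bracket_0_right [simp]: "bracket x 0 = 0"
  using bracket_scale_right[of x 0 0] by simp

lemma bracket_0_left [simp]: "bracket 0 x = 0"
  using bracket_scale_left[of 0 0 x] by simp

lemma bracket_anti: "bracket x y = - bracket y x"
proof -
  have "bracket (x + y) (x + y) = bracket x y + bracket y x"
    by (simp only: bracket_add_left bracket_add_right) (simp add: bracket_self)
  then show ?thesis
    by (simp add: bracket_self eq_neg_iff_add_eq_0)
qed

lemma bracket_minus_right: "bracket x (- y) = - bracket x y"
  using bracket_scale_right[of x "-1" y] by simp

lemma bracket_diff_right: "bracket x (y - z) = bracket x y - bracket x z"
  using bracket_add_right[of x y "- z"] by (simp add: bracket_minus_right)

lemma bracket_derivation: "bracket x (bracket y z) = bracket (bracket x y) z + bracket y (bracket x z)"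
  using jacobi[of x y z] bracket_anti[of z x] bracket_anti[of z "bracket x y"]
  by (simp add: bracket_minus_right algebra_simps)

lemma bracket_span_left:
  assumes "subspace W" "\<And>x. x \<in> S \<Longrightarrow> bracket x y \<in> W" "x \<in> span S"
  shows "bracket x y \<in> W"
  using assms(3)
proof (induction rule: span_induct)
  case base
  then show ?case
    using assms(1) by (auto simp: subspace_def bracket_add_left bracket_scale_left)
qed (rule assms(2))

lemma derived_subalgebra_mono: "S \<subseteq> T \<Longrightarrow> derived_subalgebra S \<subseteq> derived_subalgebra T"
  unfolding derived_subalgebra_def by (intro span_mono) blast

lemma bracket_in_derived: "x \<in> S \<Longrightarrow> y \<in> S \<Longrightarrow> bracket x y \<in> derived_subalgebra S"
  unfolding derived_subalgebra_def by (intro span_base) blast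

lemma derived_subset:
  assumes "subspace S" "\<And>x y. x \<in> T \<Longrightarrow> y \<in> T \<Longrightarrow> bracket x y \<in> S"
  shows "derived_subalgebra T \<subseteq> S"
  unfolding derived_subalgebra_def using assms by (intro span_minimal) auto

text \<open>A subspace inside its own derived subalgebra survives in every term of the derived
  series of L, and that series reaches 0.\<close>

lemma perfect_imp_trivial:
  assumes solvable "subspace H" "H \<subseteq> derived_subalgebra H"
  shows "H = {0}"
proof -
  have "H \<subseteq> (derived_subalgebra ^^ n) UNIV" for n
  proof (induction n)
    case (Suc n)
    from assms(3) derived_subalgebra_mono[OF Suc] show ?case
      by simp
  qed simp
  then show ?thesis
    using assms(1,2) subspace_0 unfolding solvable_def by blast
qed

lemma coeff_ad_poly:
  "coeff (ad_poly x y q) n = (case n of 0 \<Rightarrow> 0 | Suc m \<Rightarrow> bracket x (coeff q m)) + bracket y (coeff q n)"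
  by (simp add: ad_poly_def coeff_pCons coeff_map_poly split: nat.split)

text \<open>Each application of \<open>ad_poly x y\<close> turns coefficients in \<open>H\<close>
  into coefficients in \<open>K\<close>, and at least one of the p - 1 applications takes place.
  Used for an ideal \<open>K\<close> containing [H, H] and for \<open>K = {0}\<close>.\<close>

lemma jacobson_s_mem:
  assumes K: "subspace K" "K \<subseteq> H" and x: "x \<in> H"
    and br: "\<And>z. z \<in> H \<Longrightarrow> bracket x z \<in> K" "\<And>z. z \<in> H \<Longrightarrow> bracket y z \<in> K" and "p > 1"
  shows "jacobson_s p i x y \<in> K"
proof -
  have step: "coeff (ad_poly x y q) n \<in> K" if "\<And>n. coeff q n \<in> H" for q n
    using that br K by (auto simp: coeff_ad_poly subspace_0 intro!: subspace_add split: nat.split)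
  have "coeff ((ad_poly x y ^^ Suc m) [:x:]) n \<in> K" for m n
  proof (induction m arbitrary: n)
    case 0
    have "coeff [:x:] n \<in> H" for n
      using x K subspace_0 by (cases n) auto
    then show ?case
      using step by simp
  next
    case (Suc m)
    have "coeff ((ad_poly x y ^^ Suc m) [:x:]) n \<in> H" for n
      using Suc K by blast
    then show ?case
      using step by simp
  qed
  from this[of "p - 2"] show ?thesis
    unfolding jacobson_s_def using \<open>p > 1\<close> K
    by (auto intro!: subspace_scale simp: numeral_2_eq_2 Suc_diff_Suc)
qed

end

section \<open>The p-map modulo an ideal, and p-hulls\<close>

context restricted_lie_algebra
begin

lemma p_gt_1: "p > 1"
  using prime_p by (rule prime_gt_1_nat)

lemma neg_one_power_p: "(- 1 :: 'f) ^ p = - 1"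
proof -
  have "(1 + (- 1 :: 'f)) ^ p = 1 ^ p + (- 1) ^ p"
    by (rule freshmans_dream) (use prime_p char_p in auto)
  then show ?thesis
    using p_gt_1 by (simp add: power_0_left add_eq_0_iff)
qed

text \<open>All Jacobson terms lie in \<open>K\<close>. This additivity up to \<open>K\<close> makes
  the semilinear lemmas applicable to the p-map.\<close>

lemma pmap_add_mod:
  assumes "subspace K" "K \<subseteq> H" "x \<in> H"
    and "\<And>z. z \<in> H \<Longrightarrow> bracket x z \<in> K" "\<And>z. z \<in> H \<Longrightarrow> bracket y z \<in> K"
  shows "pmap (x + y) - (pmap x + pmap y) \<in> K"
  using assms jacobson_s_mem[OF assms p_gt_1] by (auto simp: pmap_add intro!: subspace_sum)

text \<open>The Jacobson terms vanish: take \<open>K = {0}\<close> and for \<open>H\<close> the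
  common centralizer of x and y.\<close>

lemma pmap_add_commute:
  assumes "bracket x y = 0"
  shows "pmap (x + y) = pmap x + pmap y"
proof -
  have "bracket y x = 0"
    using assms bracket_anti[of y x] by simp
  then show ?thesis
    using pmap_add_mod[of "{0}" "{z. bracket x z = 0 \<and> bracket y z = 0}" x y]
    by (simp add: bracket_self)
qed

lemma bracket_pmap_eq_0:
  assumes "bracket x v = 0"
  shows "bracket (pmap x) v = 0"
proof -
  have "(bracket x ^^ Suc n) v = 0" for n
    by (induction n) (auto simp: assms)
  from this[of "p - 1"] show ?thesis
    using p_gt_1 by (simp add: ad_pmap)
qed

lemma bracket_pmap_funpow_eq_0: "bracket x v = 0 \<Longrightarrow> bracket ((pmap ^^ n) x) v = 0"
  by (induction n) (auto simp: bracket_pmap_eq_0)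

lemma p_subalgebra_0: "p_subalgebra {0}"
  using torus_0 by (simp add: torus_def)

lemma p_subalgebra_hull: "p_subalgebra (p_subalgebra hull S)"
  by (rule hull_in) (auto simp: p_subalgebra_def intro!: subspace_Inter)

text \<open>Lets a bracket condition pass from a set to its p-hull. As \<open>E\<close> is contained
  in \<open>W\<close>, repeated brackets with z stay in \<open>E\<close>, and the p-map acts as the
  p-th power of ad z.\<close>

lemma p_subalgebra_transporter:
  assumes "subspace E" "E \<subseteq> W"
  shows "p_subalgebra {z. \<forall>w\<in>W. bracket z w \<in> E}"
proof -
  have "bracket (pmap z) w \<in> E" if "\<forall>w\<in>W. bracket z w \<in> E" "w \<in> W" for z w
  proof -
    have "(bracket z ^^ Suc n) w \<in> E" for n
      by (induction n) (use that assms in auto)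
    from this[of "p - 1"] show ?thesis
      using p_gt_1 by (simp add: ad_pmap)
  qed
  moreover have "bracket (bracket x y) w \<in> E"
    if "\<forall>w\<in>W. bracket x w \<in> E" "\<forall>w\<in>W. bracket y w \<in> E" "w \<in> W" for x y w
  proof -
    have "bracket (bracket x y) w = bracket x (bracket y w) - bracket y (bracket x w)"
      using bracket_derivation[of x y w] by simp
    then show ?thesis
      using that assms by (auto intro!: subspace_diff)
  qed
  ultimately show ?thesis
    unfolding p_subalgebra_def using assms(1)
    by (auto simp: subspace_def bracket_add_left bracket_scale_left)
qed

text \<open>The p-hull P of D = [H, H] still satisfies [P, P] inside [D, D]. If P were all of
  \<open>H\<close>, then D would lie in [D, D], and solvability would force D = 0 and then H =
  0.\<close>

lemma hull_derived_psubset: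
  assumes solvable "p_subalgebra H" "H \<noteq> {0}"
  shows "p_subalgebra hull derived_subalgebra H \<subset> H"
proof
  define D where "D = derived_subalgebra H"
  define E where "E = derived_subalgebra D"
  define P where "P = p_subalgebra hull D"
  have H: "subspace H" and HD: "D \<subseteq> H"
    using assms(2) derived_subset[of H H] by (auto simp: p_subalgebra_def D_def)
  show "p_subalgebra hull derived_subalgebra H \<subseteq> H"
    using HD assms(2) unfolding D_def by (rule hull_minimal)
  have E: "subspace E" "E \<subseteq> D" and D: "subspace D"
    using derived_subalgebra_mono[OF HD] by (auto simp: E_def D_def derived_subalgebra_def)
  have DP: "D \<subseteq> P"
    unfolding P_def by (rule hull_subset)
  have P_minimal: "P \<subseteq> S" if "D \<subseteq> S" "p_subalgebra S" for S
    unfolding P_def using that by (rule hull_minimal)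
  \<comment> \<open>Minimality of the hull enlarges one argument of the bracket at a time;
    antisymmetry then moves the enlarged argument to the other side.\<close>
  have "D \<subseteq> {z. \<forall>w\<in>D. bracket z w \<in> E}"
    unfolding E_def using bracket_in_derived by auto
  then have PD: "P \<subseteq> {z. \<forall>w\<in>D. bracket z w \<in> E}"
    by (rule P_minimal) (rule p_subalgebra_transporter[OF E])
  have "bracket z w \<in> E" if "z \<in> D" "w \<in> P" for z w
  proof -
    have "bracket w z \<in> E"
      using PD that by auto
    then show ?thesis
      using subspace_neg[OF E(1)] bracket_anti[of z w] by simp
  qed
  then have "D \<subseteq> {z. \<forall>w\<in>P. bracket z w \<in> E}"
    by auto
  then have PP: "P \<subseteq> {z. \<forall>w\<in>P. bracket z w \<in> E}"
    by (rule P_minimal) (rule p_subalgebra_transporter[OF E(1) order_trans[OF E(2) DP]])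
  show "p_subalgebra hull derived_subalgebra H \<noteq> H"
  proof
    assume "p_subalgebra hull derived_subalgebra H = H"
    then have PH: "P = H"
      by (simp add: P_def D_def)
    have "D \<subseteq> E"
      unfolding D_def using E(1) PP by (intro derived_subset) (auto simp: PH)
    then have "D = {0}"
      using perfect_imp_trivial[OF assms(1) D] by (simp add: E_def)
    then have "P = {0}"
      using P_minimal[of "{0}"] p_subalgebra_0 DP by auto
    then show False
      using PH assms(3) by simp
  qed
qed

end

section \<open>Ideals of codimension one in a solvable algebra\<close>

locale solvable_restricted_lie_algebra =
  restricted_lie_algebra scale bracket p pmap + finite_dimensional_vector_space scale Basis
  for scale :: "'f::alg_closed_field \<Rightarrow> 'l::ab_group_add \<Rightarrow> 'l"
    and bracket :: "'l \<Rightarrow> 'l \<Rightarrow> 'l"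
    and p :: nat
    and pmap :: "'l \<Rightarrow> 'l"
    and Basis :: "'l set" +
  assumes solvable: solvable
begin

text \<open>A normalised eigenvector of the map that \<open>pmap\<close> induces on \<open>H / K\<close>.\<close>

lemma ex_pmap_eigenvector:
  assumes H: "p_subalgebra H" and K: "p_subalgebra K" "K \<subseteq> H" "K \<noteq> H"
    and HH: "\<And>x y. x \<in> H \<Longrightarrow> y \<in> H \<Longrightarrow> bracket x y \<in> K"
  obtains z \<epsilon> where "z \<in> H" "z \<notin> K" "\<epsilon> \<in> {0, 1}" "pmap z - scale \<epsilon> z \<in> K"
proof -
  have sH: "subspace H" and sK: "subspace K" and pH: "\<And>x. x \<in> H \<Longrightarrow> pmap x \<in> H"
    using H K by (auto simp: p_subalgebra_def)
  have add: "pmap (x + y) - (pmap x + pmap y) \<in> K" if "x \<in> H" "y \<in> H" for x y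
    using that HH K by (intro pmap_add_mod[OF sK]) auto
  obtain y where y: "y \<in> H" "y \<notin> K"
    using K by blast
  have yk: "(pmap ^^ k) y \<in> H" for k
    by (induction k) (auto simp: y pH)
  define R where "R n c \<longleftrightarrow> (pmap ^^ n) y - (\<Sum>k<n. scale (c k) ((pmap ^^ k) y)) \<in> K" for n and c :: "nat \<Rightarrow> 'f"
  \<comment> \<open>A shortest relation among the p-iterates of y modulo \<open>K\<close>. Its
    length is positive because y is outside \<open>K\<close>.\<close>
  define n where "n = (LEAST n. \<exists>c. R n c)"
  have "\<exists>n c. R n c"
    unfolding R_def by (rule ex_iterate_relation[OF sK])
  then have "\<exists>c. R n c"
    unfolding n_def by (rule LeastI_ex)
  then obtain c where c: "R n c"
    by blast
  have minimal: "\<not> R m d" if "m < n" for m d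
    using not_less_Least that unfolding n_def by blast
  obtain m where m: "n = Suc m"
    using c y by (cases n) (auto simp: R_def)
  show thesis
  proof (cases "\<exists>k<n. c k \<noteq> 0")
    \<comment> \<open>All coefficients vanish, so the last iterate outside \<open>K\<close> is
      mapped into \<open>K\<close>. This gives \<open>\<epsilon> = 0\<close>.\<close>
    case False
    then have "(\<Sum>k<n. scale (c k) ((pmap ^^ k) y)) = 0"
      by (intro sum.neutral) auto
    then have "pmap ((pmap ^^ m) y) \<in> K"
      using c by (simp add: R_def m)
    moreover have "(pmap ^^ m) y \<notin> K"
      using minimal[of m "\<lambda>_. 0"] by (simp add: R_def m)
    ultimately show ?thesis
      using that[of "(pmap ^^ m) y" 0] yk by simp
  next
    case True
    \<comment> \<open>The start value 0 turns the Artin-Schreier equation into that of a fixed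
      vector modulo \<open>K\<close>, which gives \<open>\<epsilon> = 1\<close>.\<close>
    obtain e where e: "e 0 = 0" "\<And>k. e (Suc k) = e k ^ p + c k * e n ^ p"
      and "0 = (0 :: 'f) \<Longrightarrow> \<exists>k<n. c k \<noteq> 0 \<Longrightarrow> e n \<noteq> 0"
      using exists_frob_sequence[OF prime_p char_p, of 0 c n] by metis
    then have en: "e n \<noteq> 0"
      using True by simp
    define u where "u = (\<Sum>k<n. scale (e (Suc k)) ((pmap ^^ k) y))"
    have u: "u \<in> H" "u - (scale (0 ^ p) y + pmap u) \<in> K"
      unfolding u_def
      by (rule semilinear_artin_schreier[where V = H and f = pmap, OF sK sH pH add pmap_scale _ y(1) _ e],
          use c p_gt_1 in \<open>simp_all add: R_def\<close>)+
    \<comment> \<open>The top coefficient of u is \<open>e n\<close>, which is nonzero; if u were in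
      \<open>K\<close>, dividing by it would give a relation shorter by one.\<close>
    have "u \<notin> K"
    proof
      assume "u \<in> K"
      then have "scale (inverse (e n)) u \<in> K"
        by (rule subspace_scale[OF sK])
      also have "scale (inverse (e n)) u =
          (pmap ^^ m) y - (\<Sum>k<m. scale (- inverse (e n) * e (Suc k)) ((pmap ^^ k) y))"
        using en by (simp add: u_def m scale_right_distrib scale_sum_right sum_negf)
      finally show False
        using minimal[of m "\<lambda>k. - inverse (e n) * e (Suc k)"] by (simp add: R_def m)
    qed
    moreover have "pmap u - scale 1 u \<in> K"
      using subspace_neg[OF sK u(2)] p_gt_1 by (simp add: power_0_left)
    ultimately show ?thesis
      using that[of u 1] u(1) by blast
  qed
qed

text \<open>Take \<open>K\<close> of largest dimension among the proper p-subalgebras containing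
  [H, H]. Adjoining an eigenvector z of the p-map on H / K yields a larger p-subalgebra, which must
  then be all of \<open>H\<close>.\<close>

lemma ex_p_ideal_codim_1:
  assumes H: "p_subalgebra H" "H \<noteq> {0}"
  obtains K z \<epsilon> where "p_subalgebra K" "K \<subseteq> H" "z \<in> H" "z \<notin> K" "\<epsilon> \<in> {0, 1}"
    "pmap z - scale \<epsilon> z \<in> K" "\<And>x y. x \<in> H \<Longrightarrow> y \<in> H \<Longrightarrow> bracket x y \<in> K"
    "\<And>x. x \<in> H \<Longrightarrow> \<exists>a. x - scale a z \<in> K"
proof -
  define good where "good K \<longleftrightarrow> p_subalgebra K \<and> derived_subalgebra H \<subseteq> K \<and> K \<subset> H" for K
  have "good (p_subalgebra hull derived_subalgebra H)"
    using hull_derived_psubset[OF solvable H]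
    by (auto simp: good_def p_subalgebra_hull intro: hull_inc)
  moreover have "\<forall>K. good K \<longrightarrow> dim K \<le> dim UNIV"
    using dim_subset[OF subset_UNIV] by blast
  ultimately obtain K where K: "good K" and max: "\<And>K'. good K' \<Longrightarrow> dim K' \<le> dim K"
    using ex_has_greatest_nat[of good _ dim] by (metis le_imp_less_Suc less_imp_le)
  have sH: "subspace H" and sK: "subspace K" and pK: "p_subalgebra K" and KH: "K \<subseteq> H" "K \<noteq> H"
    using H K by (auto simp: p_subalgebra_def good_def)
  have HH: "bracket x y \<in> K" if "x \<in> H" "y \<in> H" for x y
    using bracket_in_derived[OF that] K by (auto simp: good_def)
  obtain z \<epsilon> where z: "z \<in> H" "z \<notin> K" "\<epsilon> \<in> {0, 1}" "pmap z - scale \<epsilon> z \<in> K"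
    by (rule ex_pmap_eigenvector[OF H(1) pK KH HH])
  define K' where "K' = span (insert z K)"
  have K'_iff: "x \<in> K' \<longleftrightarrow> (\<exists>a. x - scale a z \<in> K)" for x
    by (simp add: K'_def span_breakdown_eq span_eq_iff[THEN iffD2, OF sK])
  have sK': "subspace K'" and KK': "K \<subseteq> K'" and zK': "z \<in> K'"
    by (auto simp: K'_def span_base)
  have K'H: "K' \<subseteq> H"
    unfolding K'_def using sH z KH by (intro span_minimal) auto
  \<comment> \<open>Modulo \<open>K\<close> the p-map sends a z + k to a^p times the image of z, and
    that image is a multiple of z.\<close>
  have "pmap x \<in> K'" if x: "x \<in> K'" for x
  proof -
    obtain a where a: "x - scale a z \<in> K"
      using x K'_iff by blast
    have "pmap z \<in> K'"
      using z(4) K'_iff by blast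
    then have sum: "pmap (scale a z) + pmap (x - scale a z) \<in> K'"
      using a pK KK' sK' by (auto simp: pmap_scale p_subalgebra_def intro!: subspace_add subspace_scale)
    have "pmap (scale a z + (x - scale a z)) - (pmap (scale a z) + pmap (x - scale a z)) \<in> K'"
      using a z sH KH HH KK'
      by (intro subsetD[OF KK' pmap_add_mod[OF sK KH(1)]])
        (auto simp: bracket_scale_left intro!: subspace_scale[OF sH] subspace_scale[OF sK])
    from subspace_add[OF sK' this sum] show ?thesis
      by simp
  qed
  then have "p_subalgebra K'"
    unfolding p_subalgebra_def using sK' HH K'H KK' by blast
  moreover have "dim K < dim K'"
    using sK sK' KK' zK' z(2) by (intro dim_psubset) (auto simp: span_eq_iff[THEN iffD2])
  ultimately have "K' = H"
    using max[of K'] K K'H KK' by (auto simp: good_def)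
  then have "\<exists>a. x - scale a z \<in> K" if "x \<in> H" for x
    using that K'_iff by blast
  with HH show thesis
    by (intro that[OF pK KH(1) z])
qed

section \<open>Toral bases: enlarging them, and the tori that they span\<close>

definition toral_set :: "'l set \<Rightarrow> bool" where
  "toral_set T \<longleftrightarrow> finite T \<and> independent T \<and>
     (\<forall>t\<in>T. pmap t = t) \<and> (\<forall>s\<in>T. \<forall>t\<in>T. bracket s t = 0)"

text \<open>Since \<open>(ad t)^p = ad t\<close>, the operator \<open>1 - (ad t)^(p-1)\<close> projects onto the centralizer of \<open>t\<close>.\<close>

lemma ex_centralizing_representative:
  assumes "finite T" "T \<subseteq> K" "subspace K"
    and T: "\<And>t. t \<in> T \<Longrightarrow> pmap t = t" "\<And>s t. s \<in> T \<Longrightarrow> t \<in> T \<Longrightarrow> bracket s t = 0"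
    and K: "\<And>t x. t \<in> K \<Longrightarrow> x \<in> H \<Longrightarrow> bracket t x \<in> K" and KH: "K \<subseteq> H" and sH: "subspace H"
    and z: "z \<in> H"
  shows "\<exists>y. y - z \<in> K \<and> (\<forall>t\<in>T. bracket t y = 0)"
  using assms(1,2) T
proof (induction T)
  case empty
  show ?case
    using subspace_0[OF assms(3)] by (intro exI[of _ z]) simp
next
  case (insert s T)
  have "\<exists>y. y - z \<in> K \<and> (\<forall>t\<in>T. bracket t y = 0)"
    by (rule insert.IH) (use insert.prems in blast)+
  then obtain y where y: "y - z \<in> K" "\<forall>t\<in>T. bracket t y = 0"
    by blast
  have "y \<in> H"
    using subspace_add[OF sH _ z, of "y - z"] y KH by auto
  \<comment> \<open>Positive iterates of ad s on y lie in \<open>K\<close>, so the correction below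
    keeps y in the coset of z.\<close>
  have iter: "(bracket s ^^ Suc n) y \<in> K" for n
    by (induction n) (use insert.prems(1) KH \<open>y \<in> H\<close> in \<open>auto intro!: K\<close>)
  \<comment> \<open>ad t commutes with ad s, so correcting for s preserves what holds for the other
    elements t.\<close>
  have comm: "bracket t ((bracket s ^^ n) y) = 0" if "t \<in> T" for n t
  proof (induction n)
    case (Suc n)
    have "bracket t s = 0"
      using that by (intro insert.prems(3)) auto
    then show ?case
      using Suc bracket_derivation[of t s] by simp
  qed (use y that in simp)
  have p: "p = Suc (p - 1)" "p - 1 = Suc (p - 2)"
    using p_gt_1 by auto
  define y' where "y' = y - (bracket s ^^ (p - 1)) y"
  have "bracket s ((bracket s ^^ (p - 1)) y) = (bracket s ^^ Suc (p - 1)) y"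
    by simp
  also have "\<dots> = bracket s y"
    unfolding p(1)[symmetric] using ad_pmap[of s y] insert.prems(2)[of s] by simp
  finally have "bracket s y' = 0"
    by (simp add: y'_def bracket_diff_right)
  moreover have "bracket t y' = 0" if "t \<in> T" for t
    using comm that y by (simp add: y'_def bracket_diff_right)
  moreover have "y' - z \<in> K"
    using subspace_diff[OF assms(3) y(1) iter[of "p - 2"]] p(2) by (simp add: y'_def algebra_simps)
  ultimately show ?case
    by blast
qed

lemma commuting_span:
  assumes "\<And>x y. x \<in> Y \<Longrightarrow> y \<in> Y' \<Longrightarrow> bracket x y = 0" "x \<in> span Y" "y \<in> span Y'"
  shows "bracket x y = 0"
proof -
  have "bracket x y \<in> {0}" if "y \<in> Y'" for y
    using assms(1) that by (intro bracket_span_left[OF subspace_single_0 _ assms(2)]) auto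
  then have "bracket y x \<in> {0}" if "y \<in> Y'" for y
    using that bracket_anti[of y x] by simp
  then have "bracket y x \<in> {0}"
    by (rule bracket_span_left[OF subspace_single_0 _ assms(3)])
  then show ?thesis
    using bracket_anti[of x y] by simp
qed

lemma pmap_span:
  assumes "\<And>x y. x \<in> Y \<Longrightarrow> y \<in> Y \<Longrightarrow> bracket x y = 0" "\<And>y. y \<in> Y \<Longrightarrow> pmap y \<in> span Y" "x \<in> span Y"
  shows "pmap x \<in> span Y"
proof -
  have "x \<in> span Y \<and> pmap x \<in> span Y"
    using assms(3)
  proof (induction rule: span_induct_alt)
    case base
    show ?case
      by (simp add: pmap_0 span_zero)
  next
    case (step c x y)
    have "bracket (scale c x) y = 0"
      by (rule commuting_span[OF assms(1)]) (use step in \<open>auto intro: span_scale span_base\<close>)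
    then show ?case
      using step assms(2) by (auto simp: pmap_add_commute pmap_scale intro!: span_add span_scale intro: span_base)
  qed
  then show ?thesis ..
qed

text \<open>The p-iterates of the corrected representative y commute, so the p-map is exactly
  additive on their span, and Lang's equation can be solved there exactly, not only modulo
  \<open>K\<close>. A solution u inside \<open>K\<close> keeps y + u outside
  \<open>K\<close>.\<close>

lemma ex_toral_outside:
  assumes H: "p_subalgebra H" and K: "p_subalgebra K" "K \<subseteq> H"
    and HH: "\<And>x y. x \<in> H \<Longrightarrow> y \<in> H \<Longrightarrow> bracket x y \<in> K"
    and z: "z \<in> H" "z \<notin> K" "pmap z - z \<in> K" and T: "toral_set T" "T \<subseteq> K"
  obtains t where "t \<in> H" "t \<notin> K" "pmap t = t" "\<And>s. s \<in> T \<Longrightarrow> bracket s t = 0"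
proof -
  have sH: "subspace H" and sK: "subspace K" and pK: "\<And>x. x \<in> K \<Longrightarrow> pmap x \<in> K"
    using H K by (auto simp: p_subalgebra_def)
  have "\<exists>y. y - z \<in> K \<and> (\<forall>t\<in>T. bracket t y = 0)"
    using T HH K z sH sK by (intro ex_centralizing_representative[where H = H]) (auto simp: toral_set_def)
  then obtain y where yz: "y - z \<in> K" and yT: "\<And>t. t \<in> T \<Longrightarrow> bracket t y = 0"
    by blast
  have yH: "y \<in> H"
    using subspace_add[OF sH _ z(1), of "y - z"] yz K by auto
  have yK: "y \<notin> K"
    using subspace_diff[OF sK _ yz, of y] z(2) by auto
  define Y where "Y = range (\<lambda>k. (pmap ^^ k) y)"
  have yk: "bracket ((pmap ^^ k) y) y = 0" for k
    by (rule bracket_pmap_funpow_eq_0[OF bracket_self])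
  have "bracket y ((pmap ^^ k) y) = 0" for k
    using yk bracket_anti[of y "(pmap ^^ k) y"] by simp
  then have YY: "bracket a b = 0" if "a \<in> Y" "b \<in> Y" for a b
    using that unfolding Y_def by (elim rangeE) (simp add: bracket_pmap_funpow_eq_0)
  have "pmap a \<in> Y" if a: "a \<in> Y" for a
  proof -
    obtain k where "a = (pmap ^^ k) y"
      using a by (auto simp: Y_def)
    then have "pmap a = (pmap ^^ Suc k) y"
      by simp
    then show ?thesis
      unfolding Y_def by (rule range_eqI)
  qed
  note pY0 = this
  have pY: "pmap a \<in> span Y" if "a \<in> span Y" for a
    by (rule pmap_span[OF YY _ that]) (auto intro: span_base pY0)
  have comm: "bracket a b = 0" if "a \<in> span Y" "b \<in> span Y" for a b
    using YY that by (rule commuting_span)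
  have TY: "bracket t a = 0" if "t \<in> T" "a \<in> span Y" for t a
  proof (rule commuting_span[OF _ span_base[OF that(1)] that(2)])
    fix s b assume "s \<in> T" "b \<in> Y"
    then obtain k where b: "b = (pmap ^^ k) y"
      by (auto simp: Y_def)
    have "bracket y s = 0"
      using yT[OF \<open>s \<in> T\<close>] bracket_anti[of y s] by simp
    then have "bracket b s = 0"
      unfolding b by (rule bracket_pmap_funpow_eq_0)
    then show "bracket s b = 0"
      using bracket_anti[of s b] by simp
  qed
  have "y \<in> Y"
    by (auto simp: Y_def intro!: range_eqI[of _ _ 0])
  then have yY: "y \<in> span Y"
    by (rule span_base)
  \<comment> \<open>The failure of y to be toral. It lies in \<open>K\<close> since
    \<open>pmap z - z\<close> does and y differs from z by an element of \<open>K\<close>.\<close>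
  define w where "w = pmap y - y"
  have "pmap (z + (y - z)) - (pmap z + pmap (y - z)) \<in> K"
    using yz z K HH by (intro pmap_add_mod[OF sK K(2)]) auto
  then have "pmap y - pmap z \<in> K"
    using subspace_add[OF sK _ pK[OF yz]] by fastforce
  from subspace_diff[OF sK subspace_add[OF sK this z(3)] yz]
  have "(pmap y - pmap z) + (pmap z - z) - (y - z) \<in> K" .
  then have wK: "w \<in> K"
    by (simp add: w_def)
  have wY: "w \<in> span Y"
    unfolding w_def using yY by (intro span_diff pY)
  obtain n c where rel: "(pmap ^^ n) w - (\<Sum>k<n. scale (c k) ((pmap ^^ k) w)) \<in> {0}"
    using ex_iterate_relation[OF subspace_single_0, where f = pmap and w = w] by blast
  \<comment> \<open>The start value 1 gives the inhomogeneous equation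
    \<open>u - pmap u = w\<close>.\<close>
  obtain e :: "nat \<Rightarrow> 'f" where e: "e 0 = 1" "\<And>k. e (Suc k) = e k ^ p + c k * e n ^ p"
    using exists_frob_sequence[OF prime_p char_p, of 1 c n] by metis
  define u where "u = (\<Sum>k<n. scale (e (Suc k)) ((pmap ^^ k) w))"
  have V: "subspace (span Y \<inter> K)" "w \<in> span Y \<inter> K" "\<And>v. v \<in> span Y \<inter> K \<Longrightarrow> pmap v \<in> span Y \<inter> K"
    using wY wK pY pK by (auto intro: subspace_inter[OF subspace_span sK])
  have add: "pmap (a + b) - (pmap a + pmap b) \<in> {0}" if "a \<in> span Y \<inter> K" "b \<in> span Y \<inter> K" for a b
    using pmap_add_commute[OF comm[of a b]] that by simp
  have "p > 0"
    using p_gt_1 by simp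
  note u = semilinear_artin_schreier[where c = c and e = e,
      OF subspace_single_0 V(1,3) add pmap_scale this V(2) rel e, folded u_def]
  define t where "t = y + u"
  have "pmap t = pmap y + pmap u"
    unfolding t_def using yY u(1) by (auto intro: pmap_add_commute comm)
  then have "pmap t = t"
    using u(2) by (simp add: t_def w_def algebra_simps)
  moreover have "t \<in> H"
    unfolding t_def using u(1) K yH by (intro subspace_add sH) auto
  moreover have "t \<notin> K"
    using subspace_diff[OF sK, of t u] u(1) yK by (auto simp: t_def)
  moreover have "bracket s t = 0" if "s \<in> T" for s
    using TY[OF that] u(1) yY by (simp add: t_def bracket_add_right)
  ultimately show thesis
    using that by blast
qed

lemma pmap_toral_sum:
  assumes "toral_set T" "S \<subseteq> T"
  shows "pmap (\<Sum>t\<in>S. scale (a t) t) = (\<Sum>t\<in>S. scale (a t ^ p) t)"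
proof -
  have "finite S"
    using assms by (auto simp: toral_set_def finite_subset)
  then show ?thesis
    using assms(2)
  proof (induction S)
    case (insert s S)
    have "scale (a s) s \<in> span T" "(\<Sum>t\<in>S. scale (a t) t) \<in> span T"
      using insert.prems by (auto intro!: span_sum span_scale intro: span_base)
    then have "bracket (scale (a s) s) (\<Sum>t\<in>S. scale (a t) t) = 0"
      using assms(1) by (intro commuting_span[of T T "scale (a s) s"]) (auto simp: toral_set_def)
    moreover have "pmap s = s"
      using assms(1) insert.prems by (auto simp: toral_set_def)
    ultimately show ?case
      using insert by (simp add: pmap_add_commute pmap_scale)
  qed (simp add: pmap_0)
qed

text \<open>On the span the p-map raises coordinates to p-th powers, so it is injective. For nonzero
  x, semisimplicity follows from a shortest relation among the p-iterates of x: its coefficient at x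
  itself cannot vanish.\<close>

lemma torus_span_toral_set:
  assumes T: "toral_set T"
  shows "torus (span T)"
proof -
  have comm: "bracket x y = 0" if "x \<in> span T" "y \<in> span T" for x y
    by (rule commuting_span[of T T, OF _ that]) (use T in \<open>auto simp: toral_set_def\<close>)
  have pT: "pmap x \<in> span T" if "x \<in> span T" for x
    by (rule pmap_span[of T, OF _ _ that]) (use T in \<open>auto simp: toral_set_def intro: span_base\<close>)
  have inj: "x = 0" if x: "x \<in> span T" "pmap x = 0" for x
  proof -
    have fin: "finite T" and ind: "independent T"
      using T by (auto simp: toral_set_def)
    obtain a where a: "x = (\<Sum>t\<in>T. scale (a t) t)"
      using x(1) fin by (auto simp: span_finite)
    then have "(\<Sum>t\<in>T. scale (a t ^ p) t) = 0"
      using x(2) pmap_toral_sum[OF T order_refl, of a] by simp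
    then have "a t ^ p = 0" if "t \<in> T" for t
      using independentD[OF ind fin order_refl, of "\<lambda>t. a t ^ p"] that by blast
    then show "x = 0"
      using p_gt_1 by (auto simp: a intro!: sum.neutral)
  qed
  have "semisimple x" if x: "x \<in> span T" for x
  proof -
    define P where "P = p_subalgebra hull {pmap x}"
    have P: "subspace P" "\<And>y. y \<in> P \<Longrightarrow> pmap y \<in> P" "pmap x \<in> P"
      using p_subalgebra_hull[of "{pmap x}"] hull_subset[of "{pmap x}" p_subalgebra]
      by (auto simp: P_def p_subalgebra_def)
    have Pk: "(pmap ^^ Suc k) x \<in> P" for k
      by (induction k) (auto simp: P)
    define R where "R n c \<longleftrightarrow> (pmap ^^ n) x - (\<Sum>k<n. scale (c k) ((pmap ^^ k) x)) = 0" for n and c :: "nat \<Rightarrow> 'f"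
    define n where "n = (LEAST n. \<exists>c. R n c)"
    have "\<exists>n c. R n c"
      using ex_iterate_relation[OF subspace_single_0] by (simp add: R_def)
    then have "\<exists>c. R n c"
      unfolding n_def by (rule LeastI_ex)
    then obtain c where c: "R n c"
      by blast
    have minimal: "\<not> R m d" if "m < n" for m d
      using not_less_Least that unfolding n_def by blast
    have "x \<in> P"
    proof (cases n)
      case 0
      then show ?thesis
        using c subspace_0[OF P(1)] by (simp add: R_def)
    next
      case (Suc m)
      have rel: "(pmap ^^ Suc m) x = scale (c 0) x + (\<Sum>k<m. scale (c (Suc k)) ((pmap ^^ Suc k) x))"
        using c unfolding R_def Suc sum.lessThan_Suc_shift by simp
      show ?thesis
      proof (cases "c 0 = 0")
        case True
        \<comment> \<open>If \<open>c 0 = 0\<close>, the relation is the p-map applied to a shorter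
          one whose coefficients are p-th roots. Injectivity then gives the shorter relation,
          against minimality.\<close>
        have "\<exists>d. d ^ p = c (Suc k)" for k
          using ex_root_power[of p "c (Suc k)"] p_gt_1 by auto
        then obtain d where d: "\<And>k. d k ^ p = c (Suc k)"
          by metis
        have xk: "(pmap ^^ k) x \<in> span T" for k
          by (induction k) (auto simp: x pT)
        define v where "v = (\<Sum>k<m. scale (d k) ((pmap ^^ k) x))"
        have v: "v \<in> span T"
          unfolding v_def by (intro span_sum span_scale xk)
        have "pmap v = (\<Sum>k<m. scale (d k ^ p) ((pmap ^^ Suc k) x))"
          using semilinear_iterate_sum[where V = "span T" and f = pmap and w = x and m = m and a = d,
              OF subspace_single_0 subspace_span pT _ pmap_scale] p_gt_1 x
          by (simp add: v_def pmap_add_commute comm del: funpow.simps)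
        then have pv: "pmap v = pmap ((pmap ^^ m) x)"
          using rel True by (simp add: d)
        have "bracket ((pmap ^^ m) x) (scale (- 1) v) = 0"
          using xk v by (intro comm span_scale)
        from pmap_add_commute[OF this] have "pmap ((pmap ^^ m) x - v) = pmap ((pmap ^^ m) x) + scale ((- 1) ^ p) (pmap v)"
          by (simp only: pmap_scale) simp
        also have "\<dots> = scale (1 + (- 1) ^ p) (pmap v)"
          by (simp add: pv scale_left_distrib)
        also have "1 + (- 1) ^ p = (0 :: 'f)"
          by (simp add: neg_one_power_p)
        finally have "pmap ((pmap ^^ m) x - v) = 0"
          by simp
        with span_diff[OF xk v] have "(pmap ^^ m) x - v = 0"
          by (rule inj)
        then have "R m d"
          by (simp add: R_def v_def)
        then show ?thesis
          using minimal[of m d] Suc by simp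
      next
        case False
        \<comment> \<open>Here x is a combination of its positive p-iterates, all of which lie in
          the p-subalgebra generated by \<open>pmap x\<close>.\<close>
        have "scale (c 0) x = (pmap ^^ Suc m) x - (\<Sum>k<m. scale (c (Suc k)) ((pmap ^^ Suc k) x))"
          using rel by simp
        also have "\<dots> \<in> P"
          by (intro subspace_diff subspace_sum subspace_scale P(1) Pk)
        finally have "scale (inverse (c 0)) (scale (c 0) x) \<in> P"
          by (rule subspace_scale[OF P(1)])
        then show ?thesis
          using False by simp
      qed
    qed
    then show ?thesis
      by (simp add: semisimple_def P_def)
  qed
  then show ?thesis
    unfolding torus_def p_subalgebra_def using comm pT span_zero by simp
qed

lemma card_toral_set_le_MT:
  assumes "toral_set T"
  shows "card T \<le> MT"
proof -
  have "dim (span T) = card T"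
    using assms by (intro dim_span_eq_card_independent) (simp add: toral_set_def)
  moreover
  have "dim (span T) \<in> {dim T | T. torus T}"
    using torus_span_toral_set[OF assms] by blast
  then have "dim (span T) \<le> MT"
    unfolding MT_def by (rule Max_ge[OF torus_dims(1)[OF finite_dimensional_vector_space_axioms]])
  ultimately show ?thesis
    by simp
qed

end

section \<open>Commuting operators in characteristic p\<close>

text \<open>The binomial theorem evaluated at a vector, since \<open>L\<close> and \<open>S\<close>
  are assumed linear and commuting only on \<open>W\<close>. The induction step is Pascal's rule
  after an index shift.\<close>

lemma (in vector_space) binomial_commuting:
  assumes W: "subspace W"
    and L: "\<And>v. v \<in> W \<Longrightarrow> L v \<in> W" "\<And>v w. v \<in> W \<Longrightarrow> w \<in> W \<Longrightarrow> L (v + w) = L v + L w"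
      "\<And>a v. v \<in> W \<Longrightarrow> L (scale a v) = scale a (L v)"
    and S: "\<And>v. v \<in> W \<Longrightarrow> S v \<in> W" "\<And>v w. v \<in> W \<Longrightarrow> w \<in> W \<Longrightarrow> S (v + w) = S v + S w"
      "\<And>a v. v \<in> W \<Longrightarrow> S (scale a v) = scale a (S v)"
    and comm: "\<And>v. v \<in> W \<Longrightarrow> S (L v) = L (S v)" and v: "v \<in> W"
  shows "((\<lambda>v. L v + S v) ^^ n) v =
    (\<Sum>j\<le>n. scale (of_nat (n choose j)) ((L ^^ (n - j)) ((S ^^ j) v)))"
proof (induction n)
  case (Suc n)
  have Lk: "(L ^^ k) w \<in> W" if "w \<in> W" for k w
    by (induction k) (auto simp: L that)
  have Sk: "(S ^^ k) v \<in> W" for k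
    by (induction k) (auto simp: S v)
  have SL: "S ((L ^^ k) w) = (L ^^ k) (S w)" if "w \<in> W" for k w
    by (induction k) (auto simp: comm Lk that)
  have sum_mem: "(\<Sum>j\<in>J. scale (a j) ((L ^^ f j) ((S ^^ j) v))) \<in> W" for J a f
    by (intro subspace_sum[OF W] subspace_scale[OF W] Lk Sk)
  have apply_sum: "T (\<Sum>j\<in>J. scale (a j) ((L ^^ f j) ((S ^^ j) v))) =
      (\<Sum>j\<in>J. scale (a j) (T ((L ^^ f j) ((S ^^ j) v))))"
    if T: "\<And>v w. v \<in> W \<Longrightarrow> w \<in> W \<Longrightarrow> T (v + w) = T v + T w"
      "\<And>a v. v \<in> W \<Longrightarrow> T (scale a v) = scale a (T v)" and "finite J" for T :: "'b \<Rightarrow> 'b" and J a f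
    using \<open>finite J\<close>
  proof (induction J)
    case empty
    show ?case
      using T(2)[OF subspace_0[OF W], of 0] by simp
  next
    case (insert j J)
    have "T (scale (a j) ((L ^^ f j) ((S ^^ j) v)) + (\<Sum>j\<in>J. scale (a j) ((L ^^ f j) ((S ^^ j) v)))) =
        scale (a j) (T ((L ^^ f j) ((S ^^ j) v))) + T (\<Sum>j\<in>J. scale (a j) ((L ^^ f j) ((S ^^ j) v)))"
      using T(1)[OF subspace_scale[OF W Lk[OF Sk]] sum_mem] T(2)[OF Lk[OF Sk]] by simp
    then show ?case
      using insert by simp
  qed
  let ?b = "\<lambda>n j. of_nat (n choose j) :: 'a"
  let ?t = "\<lambda>j. (L ^^ (Suc n - j)) ((S ^^ j) v)"
  have 1: "L (\<Sum>j\<le>n. scale (?b n j) ((L ^^ (n - j)) ((S ^^ j) v))) = (\<Sum>j\<le>n. scale (?b n j) (?t j))"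
    by (subst apply_sum[OF L(2,3)]) (auto simp: Suc_diff_le intro!: sum.cong)
  have 2: "S (\<Sum>j\<le>n. scale (?b n j) ((L ^^ (n - j)) ((S ^^ j) v))) = (\<Sum>j\<le>n. scale (?b n j) (?t (Suc j)))"
    by (subst apply_sum[OF S(2,3)]) (auto simp: SL Sk)
  have "(\<Sum>j\<le>Suc n. scale (?b (Suc n) j) (?t j)) =
      ?t 0 + (\<Sum>j\<le>n. scale (?b n j) (?t (Suc j))) + (\<Sum>j\<le>n. scale (?b n (Suc j)) (?t (Suc j)))"
    by (subst sum.atMost_Suc_shift) (simp add: scale_left_distrib sum.distrib add.assoc)
  also have "\<dots> = (\<Sum>j\<le>n. scale (?b n j) (?t (Suc j))) + (\<Sum>j\<le>Suc n. scale (?b n j) (?t j))"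
    by (simp only: sum.atMost_Suc_shift[where g = "\<lambda>j. scale (?b n j) (?t j)" and n = n])
      (simp add: add_ac binomial_eq_0)
  also have "(\<Sum>j\<le>Suc n. scale (?b n j) (?t j)) = (\<Sum>j\<le>n. scale (?b n j) (?t j))"
    by (simp add: binomial_eq_0)
  finally show ?case
    using Suc 1 2 by simp
qed simp

text \<open>The inner binomial coefficients are divisible by p. The hypothesis on -1 settles the
  sign of the last term uniformly, including p = 2.\<close>

lemma (in vector_space) frobenius_commuting:
  assumes W: "subspace W"
    and L: "\<And>v. v \<in> W \<Longrightarrow> L v \<in> W" "\<And>v w. v \<in> W \<Longrightarrow> w \<in> W \<Longrightarrow> L (v + w) = L v + L w"
      "\<And>a v. v \<in> W \<Longrightarrow> L (scale a v) = scale a (L v)"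
    and R: "\<And>v. v \<in> W \<Longrightarrow> R v \<in> W" "\<And>v w. v \<in> W \<Longrightarrow> w \<in> W \<Longrightarrow> R (v + w) = R v + R w"
      "\<And>a v. v \<in> W \<Longrightarrow> R (scale a v) = scale a (R v)"
    and comm: "\<And>v. v \<in> W \<Longrightarrow> R (L v) = L (R v)" and v: "v \<in> W"
    and p: "prime p" "CHAR('a) = p" "(- 1 :: 'a) ^ p = - 1"
  shows "((\<lambda>v. L v - R v) ^^ p) v = (L ^^ p) v - (R ^^ p) v"
proof -
  define S where "S v = - R v" for v
  have LS: "(\<lambda>v. L v - R v) = (\<lambda>v. L v + S v)"
    by (simp add: S_def)
  have neg: "L (- v) = - L v" "R (- v) = - R v" if "v \<in> W" for v
    using L(3)[OF that, of "- 1"] R(3)[OF that, of "- 1"] by simp_all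
  have Rk: "(R ^^ k) v \<in> W" for k
    by (induction k) (auto simp: R v)
  have Sk: "(S ^^ k) v = scale ((- 1) ^ k) ((R ^^ k) v)" for k
    by (induction k) (auto simp: S_def R Rk scale_minus_left)
  have "((\<lambda>v. L v + S v) ^^ p) v =
      (\<Sum>j\<le>p. scale (of_nat (p choose j)) ((L ^^ (p - j)) ((S ^^ j) v)))"
    by (rule binomial_commuting[OF W L, where S = S])
      (auto simp: S_def R v neg comm subspace_neg[OF W] add.commute)
  also have "\<dots> = (\<Sum>j\<in>{0, p}. scale (of_nat (p choose j)) ((L ^^ (p - j)) ((S ^^ j) v)))"
  proof (intro sum.mono_neutral_right ballI)
    fix j assume "j \<in> {..p} - {0, p}"
    then have "p dvd p choose j"
      using p(1) by (intro dvd_choose_prime) auto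
    then have "of_nat (p choose j) = (0 :: 'a)"
      using p(2) by (simp add: of_nat_eq_0_iff_char_dvd)
    then show "scale (of_nat (p choose j)) ((L ^^ (p - j)) ((S ^^ j) v)) = 0"
      by simp
  qed auto
  also have "\<dots> = (L ^^ p) v - (R ^^ p) v"
    using prime_gt_0_nat[OF p(1)] by (simp add: Sk p(3))
  finally show ?thesis
    by (simp add: LS)
qed

text \<open>Splits linear factors off q: with q = (X - c) r, either v is an eigenvector for c, or r
  annihilates the nonzero vector (D - c) v. The application is to a space of homomorphisms with no
  bound on its dimension, so an annihilating polynomial takes the place of a dimension
  argument.\<close>

lemma eigenvector_of_annihilating_poly:
  fixes scale :: "'f::alg_closed_field \<Rightarrow> 'v::ab_group_add \<Rightarrow> 'v"
  assumes "vector_space scale" and W: "module.subspace scale W"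
    and D: "\<And>v. v \<in> W \<Longrightarrow> D v \<in> W" "\<And>v w. v \<in> W \<Longrightarrow> w \<in> W \<Longrightarrow> D (v + w) = D v + D w"
      "\<And>a v. v \<in> W \<Longrightarrow> D (scale a v) = scale a (D v)"
    and "v \<in> W" "v \<noteq> 0" "q \<noteq> 0" "degree q \<le> N"
    and "(\<Sum>i\<le>N. scale (coeff q i) ((D ^^ i) v)) = 0"
  obtains u c where "u \<in> W" "u \<noteq> 0" "D u = scale c u"
proof -
  interpret vector_space scale
    by fact
  have "\<exists>u\<in>W. u \<noteq> 0 \<and> (\<exists>c. D u = scale c u)"
    using assms(6-)
  proof (induction N arbitrary: q v)
    case 0
    then have "coeff q 0 \<noteq> 0"
      using leading_coeff_0_iff[of q] by simp
    then show ?case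
      using 0 by simp
  next
    case (Suc N)
    show ?case
    proof (cases "degree q \<le> N")
      case True
      then have "coeff q (Suc N) = 0"
        by (intro coeff_eq_0) simp
      then show ?thesis
        using Suc.IH[of v q] Suc.prems True by simp
    next
      case False
      then obtain c where c: "poly q c = 0"
        using alg_closed_imp_poly_has_root[of q] by auto
      then obtain r where q: "q = [:- c, 1:] * r"
        by (auto simp: poly_eq_0_iff_dvd)
      have "r \<noteq> 0"
        using Suc.prems q by auto
      then have r: "degree r \<le> N"
        using Suc.prems(4) unfolding q by (subst (asm) degree_mult_eq) auto
      have Dk: "(D ^^ k) v \<in> W" for k
        by (induction k) (auto simp: D Suc.prems)
      define w where "w = D v - scale c v"
      have wW: "w \<in> W"
        unfolding w_def using Suc.prems D by (intro subspace_diff subspace_scale W) auto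
      have w: "(D ^^ k) w = (D ^^ Suc k) v - scale c ((D ^^ k) v)" for k
      proof (induction k)
        case (Suc k)
        have "D ((D ^^ Suc k) v + scale (- c) ((D ^^ k) v)) = D ((D ^^ Suc k) v) + scale (- c) (D ((D ^^ k) v))"
          by (subst D(2)) (auto simp only: D(3) Dk intro!: subspace_scale[OF W])
        then show ?case
          using Suc by simp
      qed (simp add: w_def)
      \<comment> \<open>Comparing coefficients in q = (X - c) r gives r(D) w = q(D) v.\<close>
      have "(\<Sum>i\<le>N. scale (coeff r i) ((D ^^ i) w)) =
          (\<Sum>i\<le>N. scale (coeff r i) ((D ^^ Suc i) v)) - scale c (\<Sum>i\<le>N. scale (coeff r i) ((D ^^ i) v))"
        by (simp add: w scale_right_diff_distrib sum_subtractf scale_sum_right mult.commute)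
      also have "(\<Sum>i\<le>N. scale (coeff r i) ((D ^^ i) v)) = (\<Sum>i\<le>Suc N. scale (coeff r i) ((D ^^ i) v))"
        using coeff_eq_0[of r "Suc N"] r by simp
      also have "(\<Sum>i\<le>N. scale (coeff r i) ((D ^^ Suc i) v)) - scale c \<dots> =
          (\<Sum>i\<le>Suc N. scale (coeff q i) ((D ^^ i) v))"
        unfolding sum.atMost_Suc_shift
        by (simp add: q scale_left_diff_distrib sum_subtractf scale_right_distrib scale_sum_right
            scale_left_distrib sum_negf)
      finally have sum0: "(\<Sum>i\<le>N. scale (coeff r i) ((D ^^ i) w)) = 0"
        using Suc.prems by simp
      show ?thesis
      proof (cases "w = 0")
        case True
        then show ?thesis
          using Suc.prems by (auto simp: w_def)
      next
        case False
        show ?thesis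
          by (rule Suc.IH[OF wW False \<open>r \<noteq> 0\<close> r sum0])
      qed
    qed
  qed
  then show thesis
    using that by blast
qed

section \<open>Modules over p-subalgebras\<close>

context restricted_lie_algebra_rep
begin

text \<open>Relative to a subset \<open>H\<close> of L, so that the same pair serves as a module
  over every smaller p-subalgebra.\<close>

definition chi_module :: "('l \<Rightarrow> 'f) \<Rightarrow> 'l set \<Rightarrow> 'v set \<Rightarrow> ('l \<Rightarrow> 'v \<Rightarrow> 'v) \<Rightarrow> bool" where
  "chi_module \<chi> H M act \<longleftrightarrow>
     V.subspace M \<and>
     (\<forall>x\<in>H. \<forall>m\<in>M. act x m \<in> M) \<and>
     (\<forall>x\<in>H. \<forall>m\<in>M. \<forall>n\<in>M. act x (m + n) = act x m + act x n) \<and>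
     (\<forall>x\<in>H. \<forall>a. \<forall>m\<in>M. act x (scaleV a m) = scaleV a (act x m)) \<and>
     (\<forall>x\<in>H. \<forall>y\<in>H. \<forall>m\<in>M. act (x + y) m = act x m + act y m) \<and>
     (\<forall>x\<in>H. \<forall>a. \<forall>m\<in>M. act (scale a x) m = scaleV a (act x m)) \<and>
     (\<forall>x\<in>H. \<forall>y\<in>H. \<forall>m\<in>M. act (bracket x y) m = act x (act y m) - act y (act x m)) \<and>
     (\<forall>x\<in>H. \<forall>m\<in>M. (act x ^^ p) m - act (pmap x) m = scaleV (\<chi> x ^ p) m)"

definition stable :: "'l set \<Rightarrow> 'v set \<Rightarrow> ('l \<Rightarrow> 'v \<Rightarrow> 'v) \<Rightarrow> bool" where
  "stable H N act \<longleftrightarrow> V.subspace N \<and> (\<forall>x\<in>H. \<forall>n\<in>N. act x n \<in> N)"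

definition simple :: "('l \<Rightarrow> 'f) \<Rightarrow> 'l set \<Rightarrow> 'v set \<Rightarrow> ('l \<Rightarrow> 'v \<Rightarrow> 'v) \<Rightarrow> bool" where
  "simple \<chi> H M act \<longleftrightarrow>
     chi_module \<chi> H M act \<and> M \<noteq> {0} \<and> (\<forall>N. N \<subseteq> M \<and> stable H N act \<longrightarrow> N = {0} \<or> N = M)"

definition lie_hom ::
    "'l set \<Rightarrow> 'v set \<Rightarrow> ('l \<Rightarrow> 'v \<Rightarrow> 'v) \<Rightarrow> 'v set \<Rightarrow> ('l \<Rightarrow> 'v \<Rightarrow> 'v) \<Rightarrow> ('v \<Rightarrow> 'v) \<Rightarrow> bool" where
  "lie_hom H M act N act' f \<longleftrightarrow>
     (\<forall>m\<in>M. f m \<in> N) \<and>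
     (\<forall>m\<in>M. \<forall>n\<in>M. f (m + n) = f m + f n) \<and>
     (\<forall>a. \<forall>m\<in>M. f (scaleV a m) = scaleV a (f m)) \<and>
     (\<forall>x\<in>H. \<forall>m\<in>M. f (act x m) = act' x (f m))"

definition lie_iso :: "'l set \<Rightarrow> 'v set \<Rightarrow> ('l \<Rightarrow> 'v \<Rightarrow> 'v) \<Rightarrow> 'v set \<Rightarrow> ('l \<Rightarrow> 'v \<Rightarrow> 'v) \<Rightarrow> bool" where
  "lie_iso H M act N act' \<longleftrightarrow> (\<exists>f. lie_hom H M act N act' f \<and> bij_betw f M N)"

text \<open>The spanning set may leave \<open>M\<close>; thus subsets inherit the property at
  once.\<close>

definition finitely_spanned :: "'v set \<Rightarrow> bool" where
  "finitely_spanned M \<longleftrightarrow> (\<exists>B. finite B \<and> M \<subseteq> V.span B)"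

lemma
  assumes "chi_module \<chi> H M act"
  shows mod_subspace: "V.subspace M"
    and mod_mem: "x \<in> H \<Longrightarrow> m \<in> M \<Longrightarrow> act x m \<in> M"
    and mod_add: "x \<in> H \<Longrightarrow> m \<in> M \<Longrightarrow> n \<in> M \<Longrightarrow> act x (m + n) = act x m + act x n"
    and mod_scale: "x \<in> H \<Longrightarrow> m \<in> M \<Longrightarrow> act x (scaleV a m) = scaleV a (act x m)"
    and mod_add_left: "x \<in> H \<Longrightarrow> y \<in> H \<Longrightarrow> m \<in> M \<Longrightarrow> act (x + y) m = act x m + act y m"
    and mod_scale_left: "x \<in> H \<Longrightarrow> m \<in> M \<Longrightarrow> act (scale a x) m = scaleV a (act x m)"
    and mod_bracket: "x \<in> H \<Longrightarrow> y \<in> H \<Longrightarrow> m \<in> M \<Longrightarrow>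
      act (bracket x y) m = act x (act y m) - act y (act x m)"
    and mod_p_char: "x \<in> H \<Longrightarrow> m \<in> M \<Longrightarrow> (act x ^^ p) m = act (pmap x) m + scaleV (\<chi> x ^ p) m"
  using assms unfolding chi_module_def by (simp_all add: diff_eq_eq add.commute)

lemma mod_0: "chi_module \<chi> H M act \<Longrightarrow> x \<in> H \<Longrightarrow> act x 0 = 0"
  using mod_scale[of \<chi> H M act x 0 0] V.subspace_0[OF mod_subspace] by simp

lemma mod_diff:
  assumes "chi_module \<chi> H M act" "x \<in> H" "m \<in> M" "n \<in> M"
  shows "act x (m - n) = act x m - act x n"
  using mod_add[OF assms(1-3), of "scaleV (- 1) n"] mod_scale[OF assms(1,2,4), of "- 1"]
    V.subspace_scale[OF mod_subspace[OF assms(1)] assms(4), of "- 1"] by simp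

lemma
  assumes "chi_module \<chi> H M act" "x \<in> H"
  shows mod_funpow_mem: "m \<in> M \<Longrightarrow> (act x ^^ k) m \<in> M"
    and mod_funpow_add: "m \<in> M \<Longrightarrow> n \<in> M \<Longrightarrow> (act x ^^ k) (m + n) = (act x ^^ k) m + (act x ^^ k) n"
    and mod_funpow_scale: "m \<in> M \<Longrightarrow> (act x ^^ k) (scaleV a m) = scaleV a ((act x ^^ k) m)"
proof -
  show mem: "(act x ^^ k) m \<in> M" if "m \<in> M" for m k
    by (induction k) (auto simp: that intro: mod_mem[OF assms])
  show "(act x ^^ k) (m + n) = (act x ^^ k) m + (act x ^^ k) n" if "m \<in> M" "n \<in> M"
    by (induction k) (auto simp: mem that mod_add[OF assms])
  show "(act x ^^ k) (scaleV a m) = scaleV a ((act x ^^ k) m)" if "m \<in> M"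
    by (induction k) (auto simp: mem that mod_scale[OF assms])
qed

lemma mod_funpow_diff:
  assumes "chi_module \<chi> H M act" "x \<in> H" "m \<in> M" "n \<in> M"
  shows "(act x ^^ k) (m - n) = (act x ^^ k) m - (act x ^^ k) n"
  using mod_funpow_add[OF assms(1-3), of "scaleV (- 1) n"] mod_funpow_scale[OF assms(1,2,4), of k "- 1"]
    V.subspace_scale[OF mod_subspace[OF assms(1)] assms(4), of "- 1"] by simp

lemma chi_module_mono: "chi_module \<chi> H M act \<Longrightarrow> K \<subseteq> H \<Longrightarrow> chi_module \<chi> K M act"
  unfolding chi_module_def by (auto 0 3)

lemma chi_module_stable:
  assumes "chi_module \<chi> H M act" "N \<subseteq> M" "stable H N act"
  shows "chi_module \<chi> H N act"
  using assms unfolding chi_module_def stable_def by (auto simp: subset_iff)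

lemma simple_chi_module: "simple \<chi> H M act \<Longrightarrow> chi_module \<chi> H M act"
  by (simp add: simple_def)

lemma
  assumes "simple \<chi> H M act"
  shows simple_nonzero: "M \<noteq> {0}"
    and simpleD: "N \<subseteq> M \<Longrightarrow> stable H N act \<Longrightarrow> N = {0} \<or> N = M"
  using assms by (simp_all add: simple_def)

lemma simple_stable:
  assumes "simple \<chi> H S act"
  shows "stable H S act"
  unfolding stable_def
  using mod_subspace[OF simple_chi_module[OF assms]] mod_mem[OF simple_chi_module[OF assms]] by blast

lemma
  assumes "lie_hom H M act N act' f"
  shows hom_mem: "m \<in> M \<Longrightarrow> f m \<in> N"
    and hom_add: "m \<in> M \<Longrightarrow> n \<in> M \<Longrightarrow> f (m + n) = f m + f n"
    and hom_scale: "m \<in> M \<Longrightarrow> f (scaleV a m) = scaleV a (f m)"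
    and hom_act: "x \<in> H \<Longrightarrow> m \<in> M \<Longrightarrow> f (act x m) = act' x (f m)"
  using assms unfolding lie_hom_def by simp_all

lemma hom_0: "lie_hom H M act N act' f \<Longrightarrow> V.subspace M \<Longrightarrow> f 0 = 0"
  using hom_scale[of H M act N act' f 0 0] V.subspace_0 by simp

lemma hom_diff:
  assumes "lie_hom H M act N act' f" "V.subspace M" "m \<in> M" "n \<in> M"
  shows "f (m - n) = f m - f n"
  using hom_add[OF assms(1,3), of "scaleV (- 1) n"] hom_scale[OF assms(1,4), of "- 1"]
    V.subspace_scale[OF assms(2,4), of "- 1"] by simp

lemma hom_compose:
  assumes "lie_hom H M act N act' f" "lie_hom H N act' P act'' g"
  shows "lie_hom H M act P act'' (g \<circ> f)"
  using assms unfolding lie_hom_def by simp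

text \<open>The ambient space may be infinite-dimensional, so the comparison goes through a finite
  spanning set: a basis of \<open>N\<close> stays independent when a vector of \<open>M\<close>
  outside \<open>N\<close> is added.\<close>

lemma dim_strict_mono:
  assumes "V.subspace N" "N \<subset> M" "finitely_spanned M"
  shows "V.dim N < V.dim M"
proof -
  obtain B where B: "finite B" "M \<subseteq> V.span B"
    using assms(3) by (auto simp: finitely_spanned_def)
  obtain C where C: "C \<subseteq> M" "V.independent C" "M \<subseteq> V.span C" "card C = V.dim M"
    using V.basis_exists by blast
  have finC: "finite C"
    using V.independent_span_bound[OF B(1) C(2)] C(1) B(2) by blast
  obtain E where E: "E \<subseteq> N" "V.independent E" "N \<subseteq> V.span E" "card E = V.dim N"
    using V.basis_exists by blast
  have finE: "finite E"
    using V.independent_span_bound[OF B(1) E(2)] E(1) B(2) assms(2) by blast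
  obtain v where v: "v \<in> M" "v \<notin> N"
    using assms(2) by blast
  have "V.span E \<subseteq> N"
    using E(1) assms(1) by (rule V.span_minimal)
  then have "v \<notin> V.span E"
    using v by blast
  then have "V.independent (insert v E)" "v \<notin> E"
    using V.independent_insertI[OF _ E(2)] V.span_base by blast+
  moreover have "insert v E \<subseteq> V.span C"
    using v E(1) assms(2) C(3) by blast
  ultimately have "card (insert v E) \<le> card C"
    using V.independent_span_bound[OF finC] by blast
  then show ?thesis
    using \<open>v \<notin> E\<close> finE E(4) C(4) by simp
qed

lemma ex_simple_submodule:
  assumes "chi_module \<chi> H M act" "finitely_spanned M" "M \<noteq> {0}"
  shows "\<exists>N\<subseteq>M. simple \<chi> H N act \<and> finitely_spanned N"
  using assms
proof (induction "V.dim M" arbitrary: M rule: less_induct)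
  case less
  show ?case
  proof (cases "simple \<chi> H M act")
    case False
    then obtain N where N: "N \<subseteq> M" "stable H N act" "N \<noteq> {0}" "N \<noteq> M"
      using less.prems by (auto simp: simple_def)
    have "finitely_spanned N"
      using less.prems(2) N(1) by (auto simp: finitely_spanned_def)
    moreover have "V.dim N < V.dim M"
      using N less.prems(2) by (intro dim_strict_mono) (auto simp: stable_def)
    ultimately have "\<exists>P\<subseteq>N. simple \<chi> H P act \<and> finitely_spanned P"
      using chi_module_stable[OF less.prems(1) N(1,2)] N(3) by (intro less.hyps)
    then show ?thesis
      using N(1) by blast
  qed (use less.prems in blast)
qed

end

section \<open>Simple modules over an ideal of codimension one\<close>

locale codim_1_ideal =
  restricted_lie_algebra_rep scale bracket p pmap scaleV
  for scale :: "'f::alg_closed_field \<Rightarrow> 'l::ab_group_add \<Rightarrow> 'l"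
    and bracket :: "'l \<Rightarrow> 'l \<Rightarrow> 'l"
    and p :: nat
    and pmap :: "'l \<Rightarrow> 'l"
    and scaleV :: "'f \<Rightarrow> 'v::ab_group_add \<Rightarrow> 'v" +
  fixes \<chi> :: "'l \<Rightarrow> 'f"
    and H K :: "'l set"
    and z :: 'l
    and \<epsilon> :: 'f
  assumes H: "L.p_subalgebra H" and K: "L.p_subalgebra K" "K \<subseteq> H" and z: "z \<in> H"
    and bracket_H: "\<And>x y. x \<in> H \<Longrightarrow> y \<in> H \<Longrightarrow> bracket x y \<in> K"
    and decompose: "\<And>x. x \<in> H \<Longrightarrow> \<exists>a. x - scale a z \<in> K"
    and pmap_z: "pmap z - scale \<epsilon> z \<in> K"
begin

lemma K_H: "k \<in> K \<Longrightarrow> k \<in> H"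
  using K by blast

lemma H_cases:
  assumes "x \<in> H"
  obtains a k where "k \<in> K" "x = scale a z + k"
  using decompose[OF assms] by (metis add.commute diff_add_cancel)

lemma scale_z: "scale a z \<in> H"
  using H z L.subspace_scale unfolding L.p_subalgebra_def by blast

lemma act_decomposed:
  assumes "chi_module \<chi> H M act" "k \<in> K" "m \<in> M"
  shows "act (scale a z + k) m = scaleV a (act z m) + act k m"
  using mod_add_left[OF assms(1) scale_z K_H[OF assms(2)] assms(3)]
    mod_scale_left[OF assms(1) z assms(3)] by simp

lemma act_pmap_z:
  assumes "chi_module \<chi> H M act"
  obtains k where "k \<in> K" "\<And>m. m \<in> M \<Longrightarrow> act (pmap z) m = scaleV \<epsilon> (act z m) + act k m"
proof -
  have "act (pmap z) m = scaleV \<epsilon> (act z m) + act (pmap z - scale \<epsilon> z) m" if "m \<in> M" for m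
    using act_decomposed[OF assms pmap_z that, of \<epsilon>] by simp
  then show thesis
    using that pmap_z by blast
qed

lemma stable_extend:
  assumes M: "chi_module \<chi> H M act" and N: "N \<subseteq> M" "stable K N act" "\<And>n. n \<in> N \<Longrightarrow> act z n \<in> N"
  shows "stable H N act"
proof -
  have sN: "V.subspace N"
    using N by (simp add: stable_def)
  have "act x n \<in> N" if x: "x \<in> H" and n: "n \<in> N" for x n
  proof -
    obtain a k where k: "k \<in> K" "x = scale a z + k"
      using H_cases[OF x] by metis
    have "act x n = scaleV a (act z n) + act k n"
      unfolding k(2) using act_decomposed[OF M k(1)] n N(1) by blast
    also have "\<dots> \<in> N"
      using N n k(1) by (intro V.subspace_add V.subspace_scale sN) (auto simp: stable_def)
    finally show ?thesis .
  qed
  then show ?thesis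
    using sN by (simp add: stable_def)
qed

text \<open>The sum of the spaces z^j S over j < i. The index counts the powers of z in use, so
  level 0 is 0 and level 1 is \<open>S\<close>.\<close>

primrec filtration :: "('l \<Rightarrow> 'v \<Rightarrow> 'v) \<Rightarrow> 'v set \<Rightarrow> nat \<Rightarrow> 'v set" where
  "filtration act S 0 = {0}"
| "filtration act S (Suc i) = {a + (act z ^^ i) s | a s. a \<in> filtration act S i \<and> s \<in> S}"

text \<open>A joint induction, as the claims feed each other. Moving k past z produces [k, z] in
  \<open>K\<close>, whose action needs stability of the next level; that stability in turn needs k
  to commute with z^i modulo the current level.\<close>

lemma filtration_properties:
  assumes M: "chi_module \<chi> H M act" and S: "S \<subseteq> M" "stable K S act"
  shows "filtration act S i \<subseteq> M \<and> stable K (filtration act S i) act \<and>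
    (\<forall>k\<in>K. \<forall>s\<in>S. act k ((act z ^^ i) s) - (act z ^^ i) (act k s) \<in> filtration act S i) \<and>
    (\<forall>a\<in>filtration act S i. act z a \<in> filtration act S (Suc i))"
proof (induction i)
  have sS: "V.subspace S" and kS: "\<And>k s. k \<in> K \<Longrightarrow> s \<in> S \<Longrightarrow> act k s \<in> S"
    using S by (auto simp: stable_def)
  {
    case 0
    have "0 \<in> M" "0 \<in> S"
      using V.subspace_0 mod_subspace[OF M] sS by auto
    then show ?case
      using mod_0[OF M] K_H z by (auto simp: stable_def intro!: exI[of _ 0])
  next
    case (Suc i)
    let ?F = "filtration act S"
    have FM: "?F i \<subseteq> M" and F: "V.subspace (?F i)" and Fk: "\<And>k a. k \<in> K \<Longrightarrow> a \<in> ?F i \<Longrightarrow> act k a \<in> ?F i"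
      and Fc: "\<And>k s. k \<in> K \<Longrightarrow> s \<in> S \<Longrightarrow> act k ((act z ^^ i) s) - (act z ^^ i) (act k s) \<in> ?F i"
      and Fz: "\<And>a. a \<in> ?F i \<Longrightarrow> act z a \<in> ?F (Suc i)"
      using Suc by (auto simp: stable_def simp del: filtration.simps)
    have zS: "(act z ^^ j) s \<in> M" if "s \<in> S" for j s
      using mod_funpow_mem[OF M z] that S by blast
    have memI: "a + (act z ^^ i) s \<in> ?F (Suc i)" if "a \<in> ?F i" "s \<in> S" for a s
      using that by auto
    have FSM: "?F (Suc i) \<subseteq> M"
      using FM zS V.subspace_add[OF mod_subspace[OF M]] by auto
    have FS: "V.subspace (?F (Suc i))"
    proof (rule V.subspaceI)
      show "0 \<in> ?F (Suc i)"
        using memI[OF V.subspace_0[OF F] V.subspace_0[OF sS]]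
          mod_funpow_scale[OF M z, of 0 i 0] V.subspace_0[OF mod_subspace[OF M]] by simp
    next
      fix u v assume "u \<in> ?F (Suc i)" "v \<in> ?F (Suc i)"
      then obtain a s b t where u: "u = a + (act z ^^ i) s" "a \<in> ?F i" "s \<in> S"
        and v: "v = b + (act z ^^ i) t" "b \<in> ?F i" "t \<in> S"
        by auto
      have "u + v = (a + b) + (act z ^^ i) (s + t)"
        using mod_funpow_add[OF M z, of s t i] u v S(1) by (simp add: subset_iff add_ac)
      then show "u + v \<in> ?F (Suc i)"
        using memI[OF V.subspace_add[OF F u(2) v(2)] V.subspace_add[OF sS u(3) v(3)]] by simp
    next
      fix c u assume "u \<in> ?F (Suc i)"
      then obtain a s where u: "u = a + (act z ^^ i) s" "a \<in> ?F i" "s \<in> S"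
        by auto
      have "scaleV c u = scaleV c a + (act z ^^ i) (scaleV c s)"
        using mod_funpow_scale[OF M z, of s i c] u S(1) by (simp add: subset_iff V.scale_right_distrib)
      then show "scaleV c u \<in> ?F (Suc i)"
        using memI[OF V.subspace_scale[OF F u(2)] V.subspace_scale[OF sS u(3)]] by simp
    qed
    have F_mono: "a \<in> ?F (Suc i)" if "a \<in> ?F i" for a
      using memI[OF that V.subspace_0[OF sS]]
          mod_funpow_scale[OF M z, of 0 i 0] V.subspace_0[OF mod_subspace[OF M]] by simp
    have top_mem: "(act z ^^ i) s \<in> ?F (Suc i)" if "s \<in> S" for s
      using memI[OF V.subspace_0[OF F] that] by simp
    have FSk: "act k u \<in> ?F (Suc i)" if k: "k \<in> K" and u: "u \<in> ?F (Suc i)" for k u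
    proof -
      obtain a s where u: "u = a + (act z ^^ i) s" "a \<in> ?F i" "s \<in> S"
        using u by auto
      have "act k u = act k a + act k ((act z ^^ i) s)"
        using mod_add[OF M K_H[OF k], of a "(act z ^^ i) s"] u FM zS by auto
      also have "\<dots> = (act k a + (act k ((act z ^^ i) s) - (act z ^^ i) (act k s))) + (act z ^^ i) (act k s)"
        by simp
      also have "\<dots> \<in> ?F (Suc i)"
        by (intro memI V.subspace_add[OF F] Fk[OF k u(2)] Fc[OF k u(3)] kS[OF k u(3)])
      finally show ?thesis .
    qed
    \<comment> \<open>Write k z (z^i s) = [k, z] z^i s + z (k z^i s). The first term stays in level
      i + 1, and the second is handled by the commutation claim for i followed by z.\<close>
    have FSc: "act k ((act z ^^ Suc i) s) - (act z ^^ Suc i) (act k s) \<in> ?F (Suc i)" if k: "k \<in> K" and s: "s \<in> S" for k s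
    proof -
      let ?s = "(act z ^^ i) s"
      have kz: "bracket k z \<in> K"
        using bracket_H[OF K_H[OF k] z] .
      have "act k (act z ?s) = act (bracket k z) ?s + act z (act k ?s)"
        using mod_bracket[OF M K_H[OF k] z zS[OF s], of i] by simp
      moreover have "act z (act k ?s - (act z ^^ i) (act k s)) = act z (act k ?s) - act z ((act z ^^ i) (act k s))"
        using zS[OF s] zS[OF kS[OF k s]] by (intro mod_diff[OF M z] mod_mem[OF M K_H[OF k]])
      ultimately have "act k ((act z ^^ Suc i) s) - (act z ^^ Suc i) (act k s) =
          act (bracket k z) ?s + act z (act k ?s - (act z ^^ i) (act k s))"
        by simp
      also have "\<dots> \<in> ?F (Suc i)"
        by (intro V.subspace_add[OF FS] FSk[OF kz] top_mem[OF s] Fz Fc[OF k s])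
      finally show ?thesis .
    qed
    have FSz: "act z u \<in> ?F (Suc (Suc i))" if u: "u \<in> ?F (Suc i)" for u
    proof -
      obtain a s where u: "u = a + (act z ^^ i) s" "a \<in> ?F i" "s \<in> S"
        using u by auto
      have "act z u = act z a + (act z ^^ Suc i) s"
        using mod_add[OF M z, of a "(act z ^^ i) s"] u FM zS by auto
      then show ?thesis
        using Fz[OF u(2)] u(3) unfolding filtration.simps(2)[of act S "Suc i"] by blast
    qed
    show ?case
      using FSM FS FSk FSc FSz unfolding stable_def by (simp del: filtration.simps funpow.simps)
  }
qed

lemma
  assumes "chi_module \<chi> H M act" "S \<subseteq> M" "stable K S act"
  shows filtration_subset: "filtration act S i \<subseteq> M"
    and filtration_stable: "stable K (filtration act S i) act"
    and filtration_commute: "k \<in> K \<Longrightarrow> s \<in> S \<Longrightarrow>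
      act k ((act z ^^ i) s) - (act z ^^ i) (act k s) \<in> filtration act S i"
    and filtration_z: "a \<in> filtration act S i \<Longrightarrow> act z a \<in> filtration act S (Suc i)"
  using filtration_properties[OF assms, of i] by (simp_all del: filtration.simps)

lemma filtration_subspace:
  assumes "chi_module \<chi> H M act" "S \<subseteq> M" "stable K S act"
  shows "V.subspace (filtration act S i)"
  using filtration_stable[OF assms] by (simp add: stable_def)

lemma filtration_mono:
  assumes M: "chi_module \<chi> H M act" and S: "S \<subseteq> M" "stable K S act" and "i \<le> j"
  shows "filtration act S i \<subseteq> filtration act S j"
  using \<open>i \<le> j\<close>
proof (induction j rule: dec_induct)
  case (step j)
  have "(act z ^^ j) 0 = 0"
    using mod_funpow_scale[OF M z, of 0 j 0] V.subspace_0[OF mod_subspace[OF M]] by simp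
  moreover have "0 \<in> S"
    using S(2) by (simp add: stable_def V.subspace_0)
  ultimately have "a \<in> filtration act S (Suc j)" if "a \<in> filtration act S j" for a
    using that unfolding filtration.simps by (metis (mono_tags, lifting) add.right_neutral mem_Collect_eq)
  then have "filtration act S j \<subseteq> filtration act S (Suc j)"
    by blast
  then show ?case
    using step by blast
qed simp

text \<open>The p-character expresses z^p s through \<open>pmap z\<close>, which is
  \<open>\<epsilon>\<close> z plus an element of \<open>K\<close>. So z^p s already lies in level 2,
  and the filtration stops growing at level p since p is at least 2.\<close>

lemma stable_filtration_p:
  assumes M: "chi_module \<chi> H M act" and S: "S \<subseteq> M" "stable K S act"
  shows "stable H (filtration act S p) act"
proof (rule stable_extend[OF M filtration_subset[OF M S] filtration_stable[OF M S]])
  let ?F = "filtration act S"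
  fix a assume "a \<in> ?F p"
  then have "act z a \<in> ?F (Suc p)"
    by (rule filtration_z[OF M S])
  then obtain b s where b: "act z a = b + (act z ^^ p) s" "b \<in> ?F p" and s: "s \<in> S"
    by auto
  have sM: "s \<in> M"
    using s S by blast
  obtain k where k: "k \<in> K" "act (pmap z) s = scaleV \<epsilon> (act z s) + act k s"
    using act_pmap_z[OF M] sM by metis
  have p2: "1 \<le> p" "2 \<le> p"
    using L.p_gt_1 by auto
  have S1: "S \<subseteq> ?F 1"
    by auto
  then have S2: "S \<subseteq> ?F p"
    using filtration_mono[OF M S p2(1)] by blast
  have zs: "act z s \<in> ?F p"
    using filtration_z[OF M S, of s 1] S1 s filtration_mono[OF M S p2(2)]
    by (auto simp: numeral_2_eq_2 simp del: filtration.simps)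
  have "act k s \<in> S"
    using S(2) k(1) s by (simp add: stable_def)
  then have "act z a = b + (scaleV \<epsilon> (act z s) + act k s + scaleV (\<chi> z ^ p) s)" "act k s \<in> ?F p" "s \<in> ?F p"
    using S2 s mod_p_char[OF M z sM] b k by auto
  then show "act z a \<in> ?F p"
    using b(2) zs by (auto simp del: filtration.simps
        intro!: V.subspace_add[OF filtration_subspace[OF M S]] V.subspace_scale[OF filtration_subspace[OF M S]])
qed

lemma finitely_spanned_filtration:
  assumes M: "chi_module \<chi> H M act" and S: "S \<subseteq> M" "stable K S act" "finitely_spanned S"
  shows "finitely_spanned (filtration act S i)"
proof (induction i)
  case 0
  show ?case
    by (auto simp: finitely_spanned_def intro: exI[of _ "{}"])
next
  case (Suc i)
  then obtain C where C: "finite C" "filtration act S i \<subseteq> V.span C"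
    by (auto simp: finitely_spanned_def)
  obtain B where B: "finite B" "S \<subseteq> V.span B"
    using S(3) by (auto simp: finitely_spanned_def)
  \<comment> \<open>The spanning set has to lie inside \<open>S\<close>, because z is known to act
    linearly on \<open>M\<close> only and \<open>B\<close> may leave \<open>M\<close>.\<close>
  obtain E where E: "E \<subseteq> S" "V.independent E" "S \<subseteq> V.span E" "card E = V.dim S"
    by (rule V.basis_exists)
  have "finite E"
    using V.independent_span_bound[OF B(1) E(2)] E(1) B(2) by blast
  have "s \<in> M \<and> (act z ^^ i) s \<in> V.span ((act z ^^ i) ` E)" if "s \<in> V.span E" for s
    using that
  proof (induction rule: V.span_induct_alt)
    case base
    show ?case
      using mod_funpow_scale[OF M z, of 0 i 0] V.subspace_0[OF mod_subspace[OF M]] by (simp add: V.span_zero)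
  next
    case (step c x y)
    have x: "x \<in> M"
      using step E S by blast
    have cx: "scaleV c x \<in> M"
      by (rule V.subspace_scale[OF mod_subspace[OF M] x])
    have "(act z ^^ i) (scaleV c x + y) = scaleV c ((act z ^^ i) x) + (act z ^^ i) y"
      using step cx mod_funpow_add[OF M z] mod_funpow_scale[OF M z x] by simp
    then show ?case
      using step cx V.subspace_add[OF mod_subspace[OF M]]
      by (auto intro!: V.span_add V.span_scale intro: V.span_base)
  qed
  then have zS: "(act z ^^ i) s \<in> V.span ((act z ^^ i) ` E)" if "s \<in> S" for s
    using that E(3) by blast
  have "filtration act S (Suc i) \<subseteq> V.span (C \<union> (act z ^^ i) ` E)"
  proof
    fix u assume "u \<in> filtration act S (Suc i)"
    then obtain a s where u: "u = a + (act z ^^ i) s" "a \<in> filtration act S i" "s \<in> S"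
      by auto
    have "a \<in> V.span (C \<union> (act z ^^ i) ` E)" "(act z ^^ i) s \<in> V.span (C \<union> (act z ^^ i) ` E)"
      using C(2) u zS V.span_mono[of C "C \<union> (act z ^^ i) ` E"]
        V.span_mono[of "(act z ^^ i) ` E" "C \<union> (act z ^^ i) ` E"] by auto
    then show "u \<in> V.span (C \<union> (act z ^^ i) ` E)"
      unfolding u(1) by (rule V.span_add)
  qed
  then show ?case
    using C(1) \<open>finite E\<close> unfolding finitely_spanned_def by (metis finite_UnI finite_imageI)
qed

text \<open>The p-th filtration level over a finite-dimensional simple K-submodule is a nonzero
  finite-dimensional H-submodule, even if \<open>M\<close> has infinite dimension. A simple
  submodule can be found inside it.\<close>

lemma ex_simple_submodule_extend:
  assumes M: "chi_module \<chi> H M act" "M \<noteq> {0}"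
    and IH: "\<And>M act. chi_module \<chi> K M act \<Longrightarrow> M \<noteq> {0} \<Longrightarrow> \<exists>S\<subseteq>M. simple \<chi> K S act \<and> finitely_spanned S"
  shows "\<exists>S\<subseteq>M. simple \<chi> H S act \<and> finitely_spanned S"
proof -
  obtain S where S: "S \<subseteq> M" "simple \<chi> K S act" "finitely_spanned S"
    using IH[OF chi_module_mono[OF M(1) K(2)] M(2)] by blast
  have st: "stable K S act"
    using S(2) by (rule simple_stable)
  have "S \<subseteq> filtration act S 1"
    by auto
  then have "S \<subseteq> filtration act S p"
    using filtration_mono[OF M(1) S(1) st, of 1 p] L.p_gt_1 by auto
  moreover have "S \<noteq> {0}" "0 \<in> S"
    using S(2) st V.subspace_0 by (auto simp: simple_def stable_def)
  ultimately have "filtration act S p \<noteq> {0}"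
    by auto
  then have "\<exists>N\<subseteq>filtration act S p. simple \<chi> H N act \<and> finitely_spanned N"
    by (intro ex_simple_submodule finitely_spanned_filtration[OF M(1) S(1) st S(3)]
        chi_module_stable[OF M(1) filtration_subset[OF M(1) S(1) st] stable_filtration_p[OF M(1) S(1) st]])
  then show ?thesis
    using filtration_subset[OF M(1) S(1) st] by blast
qed

text \<open>All factors of the filtration of \<open>M\<close> are quotients of \<open>S\<close>; the top one is a copy of \<open>S\<close>.\<close>

lemma ex_hom_onto_simple_submodule:
  assumes M: "simple \<chi> H M act" and S: "S \<subseteq> M" "simple \<chi> K S act"
  obtains f where "lie_hom K M act S act f" "\<exists>m\<in>M. f m \<noteq> 0"
proof -
  let ?F = "filtration act S"
  note cM = simple_chi_module[OF M]
  have st: "stable K S act"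
    using S(2) by (rule simple_stable)
  have sS: "V.subspace S"
    using st by (simp add: stable_def)
  have "S \<subseteq> ?F 1"
    by auto
  then have "S \<subseteq> ?F p"
    using filtration_mono[OF cM S(1) st, of 1 p] L.p_gt_1 by auto
  moreover have "S \<noteq> {0}" "0 \<in> S"
    using S(2) sS V.subspace_0 by (auto simp: simple_def)
  ultimately have "?F p \<noteq> {0}"
    by auto
  then have "?F p = M"
    using M stable_filtration_p[OF cM S(1) st] filtration_subset[OF cM S(1) st]
    unfolding simple_def by blast
  \<comment> \<open>By simplicity the filtration reaches \<open>M\<close>. Level j is the last one
    before that, so \<open>M\<close> modulo level j is the top factor.\<close>
  define n where "n = (LEAST i. ?F i = M)"
  have n: "?F n = M"
    unfolding n_def using \<open>?F p = M\<close> by (rule LeastI)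
  obtain j where j: "n = Suc j"
    using n M by (cases n) (auto simp: simple_def)
  have FjM: "?F j \<noteq> M"
    using not_less_Least[of j "\<lambda>i. ?F i = M"] j by (simp add: n_def del: filtration.simps)
  note sub = filtration_subspace[OF cM S(1) st, of j]
  \<comment> \<open>The kernel of the map that z^j induces from \<open>S\<close> to \<open>M\<close>
    modulo level j. It is a proper K-submodule of \<open>S\<close>, hence 0.\<close>
  define A where "A = {s \<in> S. (act z ^^ j) s \<in> ?F j}"
  have zdiff: "(act z ^^ j) (s - t) = (act z ^^ j) s - (act z ^^ j) t" if "s \<in> S" "t \<in> S" for s t
    using that S(1) by (intro mod_funpow_diff[OF cM z]) auto
  have zadd: "(act z ^^ j) (s + t) = (act z ^^ j) s + (act z ^^ j) t" if "s \<in> S" "t \<in> S" for s t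
    using that S(1) by (intro mod_funpow_add[OF cM z]) auto
  have zscale: "(act z ^^ j) (scaleV c s) = scaleV c ((act z ^^ j) s)" if "s \<in> S" for s c
    using that S(1) by (intro mod_funpow_scale[OF cM z]) auto
  have kS: "act k s \<in> S" if "k \<in> K" "s \<in> S" for k s
    using st that by (simp add: stable_def)
  have z0: "(act z ^^ j) 0 = 0"
    using zscale[OF \<open>0 \<in> S\<close>, of 0] by simp
  have "stable K A act"
    unfolding stable_def
  proof (intro conjI ballI V.subspaceI)
    fix k s assume k: "k \<in> K" and "s \<in> A"
    then have s: "s \<in> S" "(act z ^^ j) s \<in> ?F j"
      by (auto simp: A_def)
    have "act k ((act z ^^ j) s) \<in> ?F j"
      using filtration_stable[OF cM S(1) st] k s(2) by (simp add: stable_def)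
    from V.subspace_diff[OF sub this filtration_commute[OF cM S(1) st k s(1)]]
    show "act k s \<in> A"
      using kS[OF k s(1)] by (simp add: A_def)
  qed (auto simp: A_def z0 \<open>0 \<in> S\<close> zadd zscale V.subspace_0[OF sub] simp del: filtration.simps
      intro: V.subspace_add[OF sub] V.subspace_scale[OF sub] V.subspace_add[OF sS] V.subspace_scale[OF sS])
  moreover have "A \<subseteq> S"
    by (auto simp: A_def)
  moreover have "A \<noteq> S"
  proof
    assume "A = S"
    then have "?F n \<subseteq> ?F j"
      unfolding j filtration.simps(2) by (auto simp: A_def intro: V.subspace_add[OF sub])
    then show False
      using n FjM filtration_subset[OF cM S(1) st, of j] by blast
  qed
  ultimately have A: "A = {0}"
    using S(2) by (auto simp: simple_def)
  \<comment> \<open>The projection of \<open>M\<close> to the top factor, which z^j identifies with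
    \<open>S\<close>. The choice is unique because \<open>A\<close> is 0.\<close>
  define f where "f m = (SOME s. s \<in> S \<and> m - (act z ^^ j) s \<in> ?F j)" for m
  have f: "f m \<in> S \<and> m - (act z ^^ j) (f m) \<in> ?F j" if "m \<in> M" for m
  proof -
    have "m \<in> ?F (Suc j)"
      using n that j by simp
    then obtain a s where "m = a + (act z ^^ j) s" "a \<in> ?F j" "s \<in> S"
      by auto
    then have "s \<in> S \<and> m - (act z ^^ j) s \<in> ?F j"
      by simp
    then show ?thesis
      unfolding f_def by (rule someI)
  qed
  have unique: "f m = s" if m: "m \<in> M" and s: "s \<in> S" "m - (act z ^^ j) s \<in> ?F j" for m s
  proof -
    have "(act z ^^ j) (f m - s) = (m - (act z ^^ j) s) - (m - (act z ^^ j) (f m))"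
      using f[OF m] s zdiff by simp
    also have "\<dots> \<in> ?F j"
      using f[OF m] s V.subspace_diff[OF sub] by blast
    finally have "f m - s \<in> A"
      using f[OF m] s V.subspace_diff[OF sS] by (simp add: A_def)
    then show ?thesis
      using A by simp
  qed
  have "lie_hom K M act S act f"
    unfolding lie_hom_def
  proof (intro conjI ballI allI)
    fix m n assume m: "m \<in> M" and n: "n \<in> M"
    note fm = f[OF m] and fn = f[OF n]
    have "(m + n) - (act z ^^ j) (f m + f n) = (m - (act z ^^ j) (f m)) + (n - (act z ^^ j) (f n))"
      using fm fn by (simp add: zadd)
    also have "\<dots> \<in> ?F j"
      using fm fn by (intro V.subspace_add[OF sub]) auto
    finally show "f (m + n) = f m + f n"
      using m n fm fn by (intro unique V.subspace_add mod_subspace[OF cM] sS) auto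
  next
    fix c m assume m: "m \<in> M"
    note fm = f[OF m]
    have "scaleV c m - (act z ^^ j) (scaleV c (f m)) = scaleV c (m - (act z ^^ j) (f m))"
      using fm by (simp add: zscale V.scale_right_diff_distrib)
    also have "\<dots> \<in> ?F j"
      using fm by (intro V.subspace_scale[OF sub]) auto
    finally show "f (scaleV c m) = scaleV c (f m)"
      using m fm by (intro unique V.subspace_scale mod_subspace[OF cM] sS) auto
  next
    fix k m assume k: "k \<in> K" and m: "m \<in> M"
    note fm = f[OF m]
    have zM: "(act z ^^ j) (f m) \<in> M"
      using fm S(1) by (intro mod_funpow_mem[OF cM z]) auto
    have "act k m - (act z ^^ j) (act k (f m)) =
        act k (m - (act z ^^ j) (f m)) + (act k ((act z ^^ j) (f m)) - (act z ^^ j) (act k (f m)))"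
      using mod_diff[OF cM K_H[OF k] m zM] by simp
    also have "\<dots> \<in> ?F j"
      using fm k filtration_stable[OF cM S(1) st, of j] filtration_commute[OF cM S(1) st k]
      by (intro V.subspace_add[OF sub]) (auto simp: stable_def)
    finally show "f (act k m) = act k (f m)"
      using fm by (intro unique mod_mem[OF cM K_H[OF k] m] kS[OF k]) auto
  qed (use f in blast)
  moreover have "\<exists>m\<in>M. f m \<noteq> 0"
  proof (rule ccontr)
    assume "\<not> ?thesis"
    then have "m \<in> ?F j" if "m \<in> M" for m
      using f[OF that] that z0 by simp
    then show False
      using FjM filtration_subset[OF cM S(1) st, of j] by blast
  qed
  ultimately show thesis
    using that by blast
qed

text \<open>A nonzero homomorphism to \<open>N\<close> from \<open>M\<close> with \<open>K\<close>
  acting as before and z acting as z + c.\<close>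

definition twisted_hom ::
    "'f \<Rightarrow> 'v set \<Rightarrow> ('l \<Rightarrow> 'v \<Rightarrow> 'v) \<Rightarrow> 'v set \<Rightarrow> ('l \<Rightarrow> 'v \<Rightarrow> 'v) \<Rightarrow> ('v \<Rightarrow> 'v) \<Rightarrow> bool" where
  "twisted_hom c M act N act' f \<longleftrightarrow>
     lie_hom K M act N act' f \<and> (\<exists>m\<in>M. f m \<noteq> 0) \<and>
     (\<forall>m\<in>M. act' z (f m) = f (act z m) + scaleV c (f m))"

text \<open>
  \<open>z\<close> acts on the \<open>K\<close>-homomorphisms from \<open>M\<close> to \<open>N\<close> by \<open>D g = z g - g z\<close>. As the
  \<open>p\<close>-characters of \<open>M\<close> and \<open>N\<close> agree, \<open>D^p = \<epsilon> D\<close>. Homomorphisms are extended by zero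
  outside \<open>M\<close>.
\<close>

lemma ex_twisted_hom:
  assumes M: "chi_module \<chi> H M act" and N: "chi_module \<chi> H N act'"
    and f: "lie_hom K M act N act' f" "\<exists>m\<in>M. f m \<noteq> 0"
  obtains c g where "c ^ p = \<epsilon> * c" "twisted_hom c M act N act' g"
proof -
  define sF where "sF a g = (\<lambda>m. scaleV a (g m))" for a and g :: "'v \<Rightarrow> 'v"
  interpret F: vector_space sF
    by unfold_locales
      (auto simp: sF_def fun_eq_iff V.scale_right_distrib V.scale_left_distrib)
  \<comment> \<open>\<open>W {}\<close> consists of all linear maps and \<open>W K\<close> of the
    K-homomorphisms. Left and right multiplication by z are handled on \<open>W {}\<close>, where
    they commute; their difference \<open>D\<close> also preserves \<open>W K\<close>.\<close>
  define W where "W Q = {g. lie_hom Q M act N act' g \<and> (\<forall>m. m \<notin> M \<longrightarrow> g m = 0)}" for Q :: "'l set"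
  define L where "L g = (\<lambda>m. if m \<in> M then act' z (g m) else 0)" for g
  define R where "R g = (\<lambda>m. if m \<in> M then g (act z m) else 0)" for g :: "'v \<Rightarrow> 'v"
  define D where "D g = L g - R g" for g
  note sM = mod_subspace[OF M] and sN = mod_subspace[OF N]
  note zM = mod_mem[OF M z] and zN = mod_mem[OF N z]
  have WD: "g m \<in> N" "m \<in> M \<Longrightarrow> n \<in> M \<Longrightarrow> g (m + n) = g m + g n"
    "m \<in> M \<Longrightarrow> g (scaleV a m) = scaleV a (g m)"
    "m \<in> M \<Longrightarrow> x \<in> Q \<Longrightarrow> g (act x m) = act' x (g m)" "m \<notin> M \<Longrightarrow> g m = 0"
    if "g \<in> W Q" for g Q m n a x
    using that hom_mem[of Q M act N act' g m] V.subspace_0[OF sN]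
    by (cases "m \<in> M"; auto simp: W_def hom_add hom_scale hom_act)+
  have WI: "g \<in> W Q" if "\<And>m. m \<in> M \<Longrightarrow> g m \<in> N"
    "\<And>m n. m \<in> M \<Longrightarrow> n \<in> M \<Longrightarrow> g (m + n) = g m + g n"
    "\<And>m a. m \<in> M \<Longrightarrow> g (scaleV a m) = scaleV a (g m)"
    "\<And>m x. m \<in> M \<Longrightarrow> x \<in> Q \<Longrightarrow> g (act x m) = act' x (g m)" "\<And>m. m \<notin> M \<Longrightarrow> g m = 0" for g Q
    using that by (simp add: W_def lie_hom_def)
  have W_sub: "F.subspace (W Q)" if "Q \<subseteq> H" for Q
  proof (rule F.subspaceI)
    show "0 \<in> W Q"
      using mod_0[OF N] that by (intro WI) (auto simp: V.subspace_0[OF sN])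
    show "g + h \<in> W Q" if "g \<in> W Q" "h \<in> W Q" for g h
      using WD[OF that(1)] WD[OF that(2)] mod_add[OF N] \<open>Q \<subseteq> H\<close>
      by (intro WI) (auto simp: V.subspace_add[OF sN] subset_iff V.scale_right_distrib add_ac)
    show "sF c g \<in> W Q" if "g \<in> W Q" for c g
      using WD[OF that] mod_scale[OF N] \<open>Q \<subseteq> H\<close>
      by (intro WI) (auto simp: sF_def V.subspace_scale[OF sN] subset_iff V.scale_right_distrib mult.commute)
  qed
  have W0: "F.subspace (W {})"
    by (rule W_sub) simp
  have WK: "W K \<subseteq> W {}"
    by (auto simp: W_def lie_hom_def)
  have L_W: "L g \<in> W {}" if "g \<in> W {}" for g
    using WD[OF that] mod_add[OF N z] mod_scale[OF N z] zN
    by (intro WI) (auto simp: L_def V.subspace_add[OF sM] V.subspace_scale[OF sM])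
  have R_W: "R g \<in> W {}" if "g \<in> W {}" for g
    using WD[OF that] mod_add[OF M z] mod_scale[OF M z] zM
    by (intro WI) (auto simp: R_def V.subspace_add[OF sM] V.subspace_scale[OF sM])
  have L_lin: "L (g + h) = L g + L h" "L (sF a g) = sF a (L g)" if "g \<in> W {}" "h \<in> W {}" for g h a
    using WD(1)[OF that(1)] WD(1)[OF that(2)] mod_add[OF N z] mod_scale[OF N z]
    by (auto simp: L_def sF_def fun_eq_iff)
  have R_lin: "R (g + h) = R g + R h" "R (sF a g) = sF a (R g)" for g h a
    by (auto simp: R_def sF_def fun_eq_iff)
  have comm: "R (L g) = L (R g)" for g
    using zM by (auto simp: L_def R_def fun_eq_iff)
  have D_lin: "D (g + h) = D g + D h" "D (sF a g) = sF a (D g)" if "g \<in> W {}" "h \<in> W {}" for g h a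
    using L_lin[OF that] R_lin by (simp_all add: D_def F.scale_right_diff_distrib)
  \<comment> \<open>Moving k past z on both sides leaves the commutator [z, k], which lies in
    \<open>K\<close> and is therefore respected by g.\<close>
  have D_WK: "D g \<in> W K" if g: "g \<in> W K" for g
  proof -
    have "D g \<in> W {}"
      unfolding D_def using WK g by (intro F.subspace_diff W0 L_W R_W) auto
    moreover have "D g (act k m) = act' k (D g m)" if k: "k \<in> K" and m: "m \<in> M" for k m
    proof -
      note kH = K_H[OF k]
      have km: "act k m \<in> M"
        using mod_mem[OF M kH m] .
      have gm: "g m \<in> N" "g (act z m) \<in> N"
        using WD(1)[OF g] by auto
      have zk: "bracket z k \<in> K"
        using bracket_H[OF z kH] .
      have "act (bracket z k) m = act z (act k m) - act k (act z m)"
        "act' (bracket z k) (g m) = act' z (act' k (g m)) - act' k (act' z (g m))"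
        using mod_bracket[OF M z kH m] mod_bracket[OF N z kH gm(1)] by auto
      moreover have "g (act (bracket z k) m) = act' (bracket z k) (g m)"
        using WD(4)[OF g m zk] .
      moreover have "g (act z (act k m) - act k (act z m)) = g (act z (act k m)) - g (act k (act z m))"
        using g zM[OF m] zM[OF km] mod_mem[OF M kH zM[OF m]]
        by (intro hom_diff[of K M act N act' g, OF _ sM]) (auto simp: W_def)
      moreover have "g (act k (act z m)) = act' k (g (act z m))" "g (act k m) = act' k (g m)"
        using WD(4)[OF g zM[OF m] k] WD(4)[OF g m k] by auto
      ultimately have "act' z (act' k (g m)) - act' k (act' z (g m)) = g (act z (act k m)) - act' k (g (act z m))"
        by simp
      then have "act' z (act' k (g m)) - g (act z (act k m)) = act' k (act' z (g m)) - act' k (g (act z m))"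
        by (simp add: algebra_simps)
      also have "\<dots> = act' k (act' z (g m) - g (act z m))"
        using mod_diff[OF N kH zN[OF gm(1)] gm(2)] by simp
      finally show ?thesis
        using m km \<open>g (act k m) = act' k (g m)\<close> by (simp add: D_def L_def R_def)
    qed
    ultimately show ?thesis
      by (auto simp: W_def lie_hom_def)
  qed
  have Lk: "(L ^^ i) g m = (act' z ^^ i) (g m)" if "m \<in> M" for g m i
    by (induction i) (auto simp: L_def that)
  have Rk: "(R ^^ i) g m = g ((act z ^^ i) m)" if "m \<in> M" for g m i
    using that
  proof (induction i arbitrary: m)
    case (Suc i)
    then show ?case
      using zM by (simp add: R_def flip: funpow_swap1)
  qed simp
  have Dp: "(D ^^ p) g = sF \<epsilon> (D g)" if g: "g \<in> W K" for g
  proof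
    fix m
    have gW: "g \<in> W {}"
      using g WK by blast
    have DpW: "(D ^^ i) g \<in> W K" for i
      by (induction i) (auto simp: g D_WK)
    show "(D ^^ p) g m = sF \<epsilon> (D g) m"
    proof (cases "m \<in> M")
      case False
      then show ?thesis
        using WD(5)[OF DpW] by (simp add: sF_def D_def L_def R_def)
    next
      case True
      have "(D ^^ p) g = (L ^^ p) g - (R ^^ p) g"
        unfolding D_def
        by (rule F.frobenius_commuting[OF W0 L_W _ _ R_W])
          (use L_lin R_lin comm gW L.prime_p L.char_p L.neg_one_power_p in auto)
      \<comment> \<open>Both p-th powers of z are rewritten by the p-character. The scalars
        \<open>\<chi> z ^ p\<close> cancel, and so do the parts of \<open>pmap z\<close> in
        \<open>K\<close>.\<close>
      then have "(D ^^ p) g m = (act' z ^^ p) (g m) - g ((act z ^^ p) m)"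
        using Lk[OF True] Rk[OF True] by simp
      also have "\<dots> = act' (pmap z) (g m) + scaleV (\<chi> z ^ p) (g m) -
          g (act (pmap z) m + scaleV (\<chi> z ^ p) m)"
        using mod_p_char[OF M z True] mod_p_char[OF N z WD(1)[OF g]] by simp
      also have "g (act (pmap z) m + scaleV (\<chi> z ^ p) m) = g (act (pmap z) m) + scaleV (\<chi> z ^ p) (g m)"
        using WD(2)[OF g] WD(3)[OF g True] V.subspace_scale[OF sM True] mod_mem[OF M _ True, of "pmap z"] H z
        by (simp add: L.p_subalgebra_def)
      finally have "(D ^^ p) g m = act' (pmap z) (g m) - g (act (pmap z) m)"
        by simp
      moreover have "act' (pmap z) (g m) = scaleV \<epsilon> (act' z (g m)) + act' (pmap z - scale \<epsilon> z) (g m)"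
        using act_decomposed[OF N pmap_z WD(1)[OF g], of \<epsilon> m] by simp
      moreover have "g (act (pmap z) m) = scaleV \<epsilon> (g (act z m)) + g (act (pmap z - scale \<epsilon> z) m)"
        using act_decomposed[OF M pmap_z True, of \<epsilon>] zM[OF True] mod_mem[OF M K_H[OF pmap_z] True]
          WD(2,3)[OF g] V.subspace_scale[OF sM zM[OF True]] by simp
      ultimately show ?thesis
        using WD(4)[OF g True pmap_z] True
        by (simp add: sF_def D_def L_def R_def V.scale_right_diff_distrib)
    qed
  qed
  define f0 where "f0 m = (if m \<in> M then f m else 0)" for m
  have f0: "f0 \<in> W K"
    using hom_mem[OF f(1)] hom_add[OF f(1)] hom_scale[OF f(1)] hom_act[OF f(1)] mod_mem[OF M K_H]
    by (intro WI) (auto simp: f0_def V.subspace_add[OF sM] V.subspace_scale[OF sM])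
  have f0_nz: "f0 \<noteq> 0"
    using f(2) by (auto simp: f0_def fun_eq_iff)
  \<comment> \<open>X^p - \<open>\<epsilon>\<close> X annihilates \<open>D\<close> on
    \<open>W K\<close>, so the nonzero \<open>f0\<close> leads to an eigenvector there.\<close>
  define q where "q = monom 1 p - [:0, \<epsilon>:]"
  have p1: "p > 1"
    by (rule L.p_gt_1)
  have coeff_q: "coeff q i = (if i = p then 1 else 0) - (if i = 1 then \<epsilon> else 0)" for i
    by (auto simp: q_def coeff_pCons split: nat.split)
  have "coeff q p = 1"
    using p1 by (simp add: coeff_q)
  then have "q \<noteq> 0"
    by auto
  moreover have "degree q \<le> p"
    using p1 by (auto simp: coeff_q intro!: degree_le)
  ultimately have q: "degree q \<le> p" "q \<noteq> 0"
    by auto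
  have "(\<Sum>i\<le>p. sF (coeff q i) ((D ^^ i) f0)) =
      (\<Sum>i\<le>p. if i = p then (D ^^ i) f0 else 0) - (\<Sum>i\<le>p. if i = 1 then sF \<epsilon> ((D ^^ i) f0) else 0)"
    unfolding sum_subtractf[symmetric] by (intro sum.cong) (auto simp: coeff_q F.scale_left_diff_distrib)
  also have "\<dots> = 0"
    using p1 Dp[OF f0] by (simp add: sum.delta')
  finally have sum0: "(\<Sum>i\<le>p. sF (coeff q i) ((D ^^ i) f0)) = 0" .
  obtain u c where u: "u \<in> W K" "u \<noteq> 0" "D u = sF c u"
    by (rule eigenvector_of_annihilating_poly[OF F.vector_space_axioms W_sub[OF K(2)] D_WK _ _ f0 f0_nz q(2,1) sum0])
      (use D_lin WK in blast)+
  have "(D ^^ i) u = sF (c ^ i) u" for i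
  proof (induction i)
    case (Suc i)
    have "D (sF (c ^ i) u) = sF (c ^ i) (D u)"
      using D_lin(2) u(1) WK by blast
    then show ?case
      using Suc u(3) by (simp add: mult.commute)
  qed simp
  then have "sF (c ^ p) u = sF (\<epsilon> * c) u"
    using Dp[OF u(1)] u(3) by simp
  then have "c ^ p = \<epsilon> * c"
    using u(2) by simp
  moreover have "twisted_hom c M act N act' u"
    unfolding twisted_hom_def
  proof (intro conjI ballI)
    show "lie_hom K M act N act' u"
      using u(1) by (simp add: W_def)
    show "\<exists>m\<in>M. u m \<noteq> 0"
      using u(2) WD(5)[OF u(1)] by (metis ext zero_fun_def)
    fix m assume "m \<in> M"
    then have "act' z (u m) - u (act z m) = scaleV c (u m)"
      using fun_cong[OF u(3), of m] by (simp add: D_def L_def R_def sF_def)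
    then show "act' z (u m) = u (act z m) + scaleV c (u m)"
      by (simp add: algebra_simps)
  qed
  ultimately show thesis
    by (rule that)
qed

text \<open>Schur's lemma: the twist changes z only by a scalar, so kernel and image are still
  H-stable.\<close>

lemma twisted_hom_bij:
  assumes M: "simple \<chi> H M act" and N: "simple \<chi> H N act'" and g: "twisted_hom c M act N act' g"
  shows "bij_betw g M N"
proof -
  note cM = simple_chi_module[OF M] and cN = simple_chi_module[OF N]
  note sM = mod_subspace[OF cM] and sN = mod_subspace[OF cN]
  have hom: "lie_hom K M act N act' g" and tw: "\<And>m. m \<in> M \<Longrightarrow> act' z (g m) = g (act z m) + scaleV c (g m)"
    and nz: "\<exists>m\<in>M. g m \<noteq> 0"
    using g by (auto simp: twisted_hom_def)
  have g0: "g 0 = 0"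
    by (rule hom_0[OF hom sM])
  have "stable H {m \<in> M. g m = 0} act"
  proof (rule stable_extend[OF cM])
    show "stable K {m \<in> M. g m = 0} act"
      unfolding stable_def
      using mod_mem[OF cM K_H] mod_0[OF cN K_H] V.subspace_0[OF sM] g0
      by (auto simp: hom_add[OF hom] hom_scale[OF hom] hom_act[OF hom] intro!: V.subspaceI
          intro: V.subspace_add[OF sM] V.subspace_scale[OF sM])
    fix m assume "m \<in> {m \<in> M. g m = 0}"
    then show "act z m \<in> {m \<in> M. g m = 0}"
      using tw[of m] mod_mem[OF cM z] mod_0[OF cN z] by auto
  qed auto
  then have "{m \<in> M. g m = 0} = {0} \<or> {m \<in> M. g m = 0} = M"
    by (intro simpleD[OF M]) auto
  then have ker: "{m \<in> M. g m = 0} = {0}"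
    using nz by blast
  have "inj_on g M"
  proof (rule inj_onI)
    fix m n assume mn: "m \<in> M" "n \<in> M" "g m = g n"
    then have "m - n \<in> {m \<in> M. g m = 0}"
      using hom_diff[OF hom sM] V.subspace_diff[OF sM] by simp
    then show "m = n"
      using ker by simp
  qed
  have gN: "g ` M \<subseteq> N"
    using hom_mem[OF hom] by blast
  have sub: "V.subspace (g ` M)"
  proof (rule V.subspaceI)
    show "0 \<in> g ` M"
      using g0 V.subspace_0[OF sM] by (metis imageI)
    show "a + b \<in> g ` M" if "a \<in> g ` M" "b \<in> g ` M" for a b
      using that V.subspace_add[OF sM] by (auto simp flip: hom_add[OF hom])
    show "scaleV r a \<in> g ` M" if "a \<in> g ` M" for r a
      using that V.subspace_scale[OF sM] by (auto simp flip: hom_scale[OF hom])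
  qed
  have "stable H (g ` M) act'"
  proof (rule stable_extend[OF cN gN])
    show "stable K (g ` M) act'"
      unfolding stable_def using sub mod_mem[OF cM K_H] by (auto simp flip: hom_act[OF hom])
    fix n assume "n \<in> g ` M"
    then obtain m where m: "m \<in> M" "n = g m"
      by blast
    have "g (act z m) + scaleV c (g m) \<in> g ` M"
      using m mod_mem[OF cM z] by (intro V.subspace_add V.subspace_scale sub) auto
    then show "act' z n \<in> g ` M"
      using tw m by simp
  qed
  then have "g ` M = {0} \<or> g ` M = N"
    by (rule simpleD[OF N gN])
  then have "g ` M = N"
    using nz by blast
  then show ?thesis
    using \<open>inj_on g M\<close> by (simp add: bij_betw_def)
qed

text \<open>Equal twists cancel: h composed with the inverse of g commutes with z as well as with
  \<open>K\<close>.\<close>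

lemma twisted_homs_imp_iso:
  assumes R: "simple \<chi> H R act" and M: "simple \<chi> H M act1" and N: "simple \<chi> H N act2"
    and g: "twisted_hom c R act M act1 g" and h: "twisted_hom c R act N act2 h"
  shows "lie_iso H M act1 N act2"
proof -
  note cR = simple_chi_module[OF R] and cM = simple_chi_module[OF M] and cN = simple_chi_module[OF N]
  note sR = mod_subspace[OF cR]
  have bg: "bij_betw g R M" and bh: "bij_betw h R N"
    using twisted_hom_bij[OF R M g] twisted_hom_bij[OF R N h] by auto
  have hg: "lie_hom K R act M act1 g" and hh: "lie_hom K R act N act2 h"
    and tg: "\<And>r. r \<in> R \<Longrightarrow> act1 z (g r) = g (act z r) + scaleV c (g r)"
    and th: "\<And>r. r \<in> R \<Longrightarrow> act2 z (h r) = h (act z r) + scaleV c (h r)"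
    using g h by (auto simp: twisted_hom_def)
  define f where "f = h \<circ> inv_into R g"
  have bf: "bij_betw f M N"
    unfolding f_def using bij_betw_inv_into[OF bg] bh by (rule bij_betw_trans)
  have f: "f (g r) = h r" if "r \<in> R" for r
    using bij_betw_inv_into_left[OF bg that] by (simp add: f_def)
  have M_eq: "M = g ` R"
    using bg by (simp add: bij_betw_def)
  have "lie_hom H M act1 N act2 f"
    unfolding lie_hom_def M_eq
  proof (intro conjI ballI allI; elim imageE)
    fix m r assume "m = g r" "r \<in> R"
    then show "f m \<in> N"
      using f bh by (auto simp: bij_betw_def)
  next
    fix m n r s assume "m = g r" "r \<in> R" "n = g s" "s \<in> R"
    then show "f (m + n) = f m + f n"
      using f[of "r + s"] f hom_add[OF hg] hom_add[OF hh] V.subspace_add[OF sR] by simp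
  next
    fix a m r assume "m = g r" "r \<in> R"
    then show "f (scaleV a m) = scaleV a (f m)"
      using f[of "scaleV a r"] f hom_scale[OF hg] hom_scale[OF hh] V.subspace_scale[OF sR] by simp
  next
    fix x m r assume x: "x \<in> H" and m: "m = g r" and r: "r \<in> R"
    obtain a k where k: "k \<in> K" "x = scale a z + k"
      using H_cases[OF x] by metis
    have zr: "act z r \<in> R" and kr: "act k r \<in> R" and cr: "scaleV c r \<in> R"
      and s: "scaleV a (act z r + scaleV c r) \<in> R"
      using r z K_H[OF k(1)] by (auto intro!: mod_mem[OF cR] V.subspace_scale[OF sR] V.subspace_add[OF sR])
    \<comment> \<open>The twisted action of x on r, computed in \<open>R\<close>. Both g and h turn
      it into the action of x, as they share the same c.\<close>
    define r' where "r' = scaleV a (act z r + scaleV c r) + act k r"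
    have r': "r' \<in> R"
      unfolding r'_def by (rule V.subspace_add[OF sR s kr])
    have *: "\<phi> r' = act' x (\<phi> r)"
      if "lie_hom K R act P act' \<phi>" "act' z (\<phi> r) = \<phi> (act z r) + scaleV c (\<phi> r)" "chi_module \<chi> H P act'"
      for \<phi> P act'
    proof -
      have "\<phi> r' = scaleV a (\<phi> (act z r) + scaleV c (\<phi> r)) + act' k (\<phi> r)"
        unfolding r'_def
        using hom_add[OF that(1) s kr] hom_scale[OF that(1) V.subspace_add[OF sR zr cr], of a]
          hom_add[OF that(1) zr cr] hom_scale[OF that(1) r, of c] hom_act[OF that(1) k(1) r] by simp
      also have "\<dots> = act' x (\<phi> r)"
        unfolding k(2) using act_decomposed[OF that(3) k(1) hom_mem[OF that(1) r], of a] that(2) by simp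
      finally show ?thesis .
    qed
    show "f (act1 x m) = act2 x (f m)"
      using *[OF hg tg[OF r] cM] *[OF hh th[OF r] cN] f[OF r] f[OF r'] by (simp add: m)
  qed
  then show ?thesis
    unfolding lie_iso_def using bf by blast
qed

text \<open>A nonzero K-homomorphism from \<open>M\<close> to its submodule \<open>S\<close>,
  followed by the isomorphism to \<open>T\<close> and the inclusion in \<open>N\<close>, shows that
  the space of K-homomorphisms is nonzero.\<close>

lemma ex_twisted_hom_of_iso:
  assumes M: "simple \<chi> H M act" and N: "simple \<chi> H N act'"
    and S: "S \<subseteq> M" "simple \<chi> K S act" and T: "T \<subseteq> N"
    and iso: "lie_iso K S act T act'"
  obtains c g where "c ^ p = \<epsilon> * c" "twisted_hom c M act N act' g"
proof -
  obtain h where h: "lie_hom K S act T act' h" "bij_betw h S T"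
    using iso by (auto simp: lie_iso_def)
  obtain f where f: "lie_hom K M act S act f" "\<exists>m\<in>M. f m \<noteq> 0"
    by (rule ex_hom_onto_simple_submodule[OF M S])
  have sS: "V.subspace S"
    by (rule mod_subspace[OF simple_chi_module[OF S(2)]])
  have "lie_hom K M act T act' (h \<circ> f)"
    by (rule hom_compose[OF f(1) h(1)])
  then have hf: "lie_hom K M act N act' (h \<circ> f)"
    using T by (auto simp: lie_hom_def)
  obtain m where m: "m \<in> M" "f m \<noteq> 0"
    using f(2) by blast
  then have "h (f m) \<noteq> h 0"
    using h(2) hom_mem[OF f(1)] V.subspace_0[OF sS] by (auto simp: bij_betw_def inj_on_eq_iff)
  then have "\<exists>m\<in>M. (h \<circ> f) m \<noteq> 0"
    using hom_0[OF h(1) sS] m(1) by auto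
  then show thesis
    by (rule ex_twisted_hom[OF simple_chi_module[OF M] simple_chi_module[OF N] hf _ that])
qed

end

section \<open>Counting simple modules: the zero algebra and the step from \<open>K\<close> to
  \<open>H\<close>\<close>

context restricted_lie_algebra_rep
begin

definition has_simple_submodules :: "('l \<Rightarrow> 'f) \<Rightarrow> 'l set \<Rightarrow> bool" where
  "has_simple_submodules \<chi> H \<longleftrightarrow> (\<forall>M act. chi_module \<chi> H M act \<longrightarrow> M \<noteq> {0} \<longrightarrow>
     (\<exists>S\<subseteq>M. simple \<chi> H S act \<and> finitely_spanned S))"

text \<open>Counts isomorphism classes by a numbering that is injective up to isomorphism, without
  forming a quotient.\<close>

definition at_most_simples :: "('l \<Rightarrow> 'f) \<Rightarrow> 'l set \<Rightarrow> nat \<Rightarrow> bool" where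
  "at_most_simples \<chi> H n \<longleftrightarrow> (\<exists>code. \<forall>M act. simple \<chi> H M act \<longrightarrow> code M act < n \<and>
     (\<forall>N act'. simple \<chi> H N act' \<longrightarrow> code M act = code N act' \<longrightarrow> lie_iso H M act N act'))"

lemma at_most_simplesE:
  assumes "at_most_simples \<chi> H n"
  obtains code where "\<forall>M act. simple \<chi> H M act \<longrightarrow> code M act < n"
    "\<forall>M act N act'. simple \<chi> H M act \<longrightarrow> simple \<chi> H N act' \<longrightarrow> code M act = code N act' \<longrightarrow>
      lie_iso H M act N act'"
proof -
  from assms obtain code where "\<forall>M act. simple \<chi> H M act \<longrightarrow> code M act < n \<and>
     (\<forall>N act'. simple \<chi> H N act' \<longrightarrow> code M act = code N act' \<longrightarrow> lie_iso H M act N act')"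
    unfolding at_most_simples_def by (rule exE)
  then show thesis
    by (intro that[of code]) simp_all
qed

lemma at_most_simplesI:
  assumes "\<And>M act. simple \<chi> H M act \<Longrightarrow> code M act < n"
    "\<And>M act N act'. simple \<chi> H M act \<Longrightarrow> simple \<chi> H N act' \<Longrightarrow> code M act = code N act' \<Longrightarrow>
      lie_iso H M act N act'"
  shows "at_most_simples \<chi> H n"
  unfolding at_most_simples_def using assms by (intro exI[of _ code]) simp

lemma at_most_simples_mono:
  assumes "at_most_simples \<chi> H n" "n \<le> m"
  shows "at_most_simples \<chi> H m"
proof -
  obtain code where "\<forall>M act. simple \<chi> H M act \<longrightarrow> code M act < n"
    and "\<forall>M act N act'. simple \<chi> H M act \<longrightarrow> simple \<chi> H N act' \<longrightarrow> code M act = code N act' \<longrightarrow>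
      lie_iso H M act N act'"
    by (rule at_most_simplesE[OF assms(1)])
  then show ?thesis
    using assms(2) by (intro at_most_simplesI[of _ _ code]) (blast intro: less_le_trans)+
qed

lemma chi_module_0:
  assumes "chi_module \<chi> {0} M act" "m \<in> M"
  shows "act 0 m = 0"
  using mod_scale_left[OF assms(1) _ assms(2), of 0 0] by simp

text \<open>Over the zero algebra every subspace of a module is stable, so simplicity is a matter of
  dimension one.\<close>

lemma simple_line:
  assumes M: "chi_module \<chi> {0} M act" and v: "v \<in> M" "v \<noteq> 0"
  shows "V.span {v} \<subseteq> M" "simple \<chi> {0} (V.span {v}) act"
proof -
  have sM: "V.subspace M"
    by (rule mod_subspace[OF M])
  show sub: "V.span {v} \<subseteq> M"
    using v sM by (intro V.span_minimal) auto
  have "stable {0} (V.span {v}) act"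
    using sub chi_module_0[OF M] V.span_zero by (auto simp: stable_def)
  then have "chi_module \<chi> {0} (V.span {v}) act"
    by (rule chi_module_stable[OF M sub])
  moreover have "V.span {v} \<noteq> {0}"
    using v(2) V.span_base[of v "{v}"] by auto
  moreover have "N = {0} \<or> N = V.span {v}" if N: "N \<subseteq> V.span {v}" "stable {0} N act" for N
  proof (cases "N \<subseteq> {0}")
    case True
    then show ?thesis
      using N(2) V.subspace_0 by (auto simp: stable_def)
  next
    case False
    then obtain w where w: "w \<in> N" "w \<noteq> 0"
      by blast
    obtain a where a: "w = scaleV a v"
      using w(1) N(1) by (auto simp: V.span_singleton)
    have "scaleV (inverse a) w \<in> N"
      using w(1) N(2) by (auto simp: stable_def V.subspace_scale)
    then have "v \<in> N"
      using w(2) by (simp add: a)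
    then have "V.span {v} \<subseteq> N"
      using N(2) by (intro V.span_minimal) (auto simp: stable_def)
    then show ?thesis
      using N(1) by blast
  qed
  ultimately show "simple \<chi> {0} (V.span {v}) act"
    by (simp add: simple_def)
qed

lemma simple_trivial:
  assumes "simple \<chi> {0} M act"
  obtains v where "v \<noteq> 0" "M = V.span {v}"
proof -
  note M = simple_chi_module[OF assms]
  obtain v where v: "v \<in> M" "v \<noteq> 0"
    using simple_nonzero[OF assms] V.subspace_0[OF mod_subspace[OF M]] by blast
  have "V.span {v} = {0} \<or> V.span {v} = M"
    by (rule simpleD[OF assms simple_line(1)[OF M v] simple_stable[OF simple_line(2)[OF M v]]])
  moreover have "V.span {v} \<noteq> {0}"
    using v(2) V.span_base[of v "{v}"] by auto
  ultimately show thesis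
    using that v(2) by blast
qed

lemma trivial_algebra:
  shows "has_simple_submodules \<chi> {0}" "at_most_simples \<chi> {0} 1"
proof -
  have "\<exists>S\<subseteq>M. simple \<chi> {0} S act \<and> finitely_spanned S" if M: "chi_module \<chi> {0} M act" "M \<noteq> {0}" for M act
  proof -
    obtain v where v: "v \<in> M" "v \<noteq> 0"
      using M(2) V.subspace_0[OF mod_subspace[OF M(1)]] by blast
    have "finitely_spanned (V.span {v})"
      unfolding finitely_spanned_def by blast
    then show ?thesis
      using simple_line[OF M(1) v] by blast
  qed
  then show "has_simple_submodules \<chi> {0}"
    by (simp add: has_simple_submodules_def)
  have "lie_iso {0} M act N act'" if M: "simple \<chi> {0} M act" and N: "simple \<chi> {0} N act'" for M act N act'
  proof -
    obtain v w where v: "v \<noteq> 0" "M = V.span {v}" and w: "w \<noteq> 0" "N = V.span {w}"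
      using simple_trivial[OF M] simple_trivial[OF N] by metis
    define f where "f m = scaleV (THE a. m = scaleV a v) w" for m
    have f: "f (scaleV a v) = scaleV a w" for a
      using v(1) by (simp add: f_def)
    have Mv: "M = range (\<lambda>a. scaleV a v)" and Nw: "N = range (\<lambda>a. scaleV a w)"
      using v(2) w(2) by (auto simp: V.span_singleton)
    have "bij_betw f M N"
    proof (rule bij_betwI')
      show "f m = f n \<longleftrightarrow> m = n" if "m \<in> M" "n \<in> M" for m n
        using that f w(1) v(1) by (auto simp: Mv)
      show "\<exists>m\<in>M. n = f m" if "n \<in> N" for n
        using that by (auto simp: Mv Nw f)
    qed (auto simp: Mv Nw f)
    moreover have "f (m + n) = f m + f n" if "m \<in> M" "n \<in> M" for m n
    proof -
      obtain a b where "m = scaleV a v" "n = scaleV b v"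
        using \<open>m \<in> M\<close> \<open>n \<in> M\<close> by (auto simp: Mv)
      then show ?thesis
        using f[of "a + b"] by (simp add: f V.scale_left_distrib)
    qed
    moreover have "f (scaleV a m) = scaleV a (f m)" if "m \<in> M" for a m
    proof -
      obtain b where "m = scaleV b v"
        using \<open>m \<in> M\<close> by (auto simp: Mv)
      then show ?thesis
        using f[of "a * b"] by (simp add: f)
    qed
    moreover have "f m \<in> N" if "m \<in> M" for m
      using that by (auto simp: Mv Nw f)
    moreover have "f (act 0 m) = act' 0 (f m)" if "m \<in> M" for m
      using chi_module_0[OF simple_chi_module[OF M] that] f[of 0] \<open>\<And>m. m \<in> M \<Longrightarrow> f m \<in> N\<close>[OF that]
        chi_module_0[OF simple_chi_module[OF N]] by simp
    ultimately show ?thesis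
      unfolding lie_iso_def lie_hom_def by (intro exI[of _ f]) simp
  qed
  then show "at_most_simples \<chi> {0} 1"
    by (intro at_most_simplesI[of _ _ "\<lambda>_ _. 0"]) simp_all
qed

end

text \<open>A simple H-module gets two labels: the code of a chosen simple K-submodule, and a twist
  c relating it to a fixed reference module with the same K-code. Equal labels mean equal twists of
  one reference module.\<close>

lemma (in codim_1_ideal) at_most_simples_extend:
  assumes sub: "has_simple_submodules \<chi> K" and "at_most_simples \<chi> K n"
    and C: "finite {c. c ^ p = \<epsilon> * c}"
  shows "at_most_simples \<chi> H (n * card {c. c ^ p = \<epsilon> * c})"
proof -
  obtain code where code: "\<forall>M act. simple \<chi> K M act \<longrightarrow> code M act < n"
    and code_iso: "\<forall>M act N act'. simple \<chi> K M act \<longrightarrow> simple \<chi> K N act' \<longrightarrow> code M act = code N act' \<longrightarrow>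
      lie_iso K M act N act'"
    by (rule at_most_simplesE[OF assms(2)])
  define C where "C = {c. c ^ p = \<epsilon> * c}"
  obtain idx :: "'f \<Rightarrow> nat" where idx: "bij_betw idx C {0..<card C}"
    using ex_bij_betw_finite_nat assms(3) unfolding C_def by blast
  define S where "S M act = (SOME S. S \<subseteq> M \<and> simple \<chi> K S act)" for M act
  have S: "S M act \<subseteq> M \<and> simple \<chi> K (S M act) act" if "simple \<chi> H M act" for M act
  proof -
    have "chi_module \<chi> K M act" "M \<noteq> {0}"
      using chi_module_mono[OF simple_chi_module[OF that] K(2)] that by (auto simp: simple_def)
    then have "\<exists>S. S \<subseteq> M \<and> simple \<chi> K S act"
      using sub unfolding has_simple_submodules_def by blast
    then show ?thesis
      unfolding S_def by (rule someI_ex)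
  qed
  define \<kappa> where "\<kappa> M act = code (S M act) act" for M act
  \<comment> \<open>The reference module for the K-code i, evaluated only at codes that occur, where
    the choice is meaningful.\<close>
  define R where "R i = (SOME X. simple \<chi> H (fst X) (snd X) \<and> \<kappa> (fst X) (snd X) = i)" for i
  have R: "simple \<chi> H (fst (R (\<kappa> M act))) (snd (R (\<kappa> M act)))"
    "\<kappa> (fst (R (\<kappa> M act))) (snd (R (\<kappa> M act))) = \<kappa> M act" if "simple \<chi> H M act" for M act
  proof -
    have "simple \<chi> H (fst (M, act)) (snd (M, act)) \<and> \<kappa> (fst (M, act)) (snd (M, act)) = \<kappa> M act"
      using that by simp
    then have "simple \<chi> H (fst (R (\<kappa> M act))) (snd (R (\<kappa> M act))) \<and>
        \<kappa> (fst (R (\<kappa> M act))) (snd (R (\<kappa> M act))) = \<kappa> M act"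
      unfolding R_def by (rule someI)
    then show "simple \<chi> H (fst (R (\<kappa> M act))) (snd (R (\<kappa> M act)))"
      "\<kappa> (fst (R (\<kappa> M act))) (snd (R (\<kappa> M act))) = \<kappa> M act"
      by auto
  qed
  define tw where "tw M act c \<longleftrightarrow> c \<in> C \<and>
    (\<exists>g. twisted_hom c (fst (R (\<kappa> M act))) (snd (R (\<kappa> M act))) M act g)" for M act c
  define d where "d M act = (SOME c. tw M act c)" for M act
  have d: "tw M act (d M act)" if M: "simple \<chi> H M act" for M act
  proof -
    obtain M' act' where M': "R (\<kappa> M act) = (M', act')"
      by fastforce
    have simp': "simple \<chi> H M' act'" and "\<kappa> M' act' = \<kappa> M act"
      using R[OF M] by (auto simp: M')
    then have "lie_iso K (S M' act') act' (S M act) act"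
      using S[OF M] S[OF simp'] code_iso by (simp add: \<kappa>_def)
    then obtain c g where "c ^ p = \<epsilon> * c" "twisted_hom c M' act' M act g"
      using ex_twisted_hom_of_iso[OF simp' M, where S = "S M' act'" and T = "S M act"]
        S[OF simp'] S[OF M] by blast
    then have "tw M act c"
      by (auto simp: tw_def C_def M')
    then show ?thesis
      unfolding d_def by (rule someI)
  qed
  \<comment> \<open>The two labels are packed in base \<open>card C\<close>, so division by
    \<open>card C\<close> recovers the first one.\<close>
  define code' where "code' M act = \<kappa> M act * card C + idx (d M act)" for M act
  have idx_less: "idx (d M act) < card C" if "simple \<chi> H M act" for M act
    using d[OF that] idx by (auto simp: tw_def bij_betw_def)
  have less: "code' M act < n * card C" if M: "simple \<chi> H M act" for M act
  proof -
    have "\<kappa> M act < n"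
      unfolding \<kappa>_def using S[OF M] code by simp
    then have "Suc (\<kappa> M act) * card C \<le> n * card C"
      by (intro mult_le_mono) auto
    then show ?thesis
      using idx_less[OF M] by (simp add: code'_def)
  qed
  have iso: "lie_iso H M act N act'"
    if M: "simple \<chi> H M act" and N: "simple \<chi> H N act'" and eq: "code' M act = code' N act'" for M act N act'
  proof -
    have pos: "card C > 0"
      using idx_less[OF M] by simp
    have "\<kappa> M act = code' M act div card C" "\<kappa> N act' = code' N act' div card C"
      using idx_less[OF M] idx_less[OF N] by (simp_all add: code'_def)
    then have \<kappa>_eq: "\<kappa> M act = \<kappa> N act'"
      using eq by simp
    then have "idx (d M act) = idx (d N act')"
      using eq by (simp add: code'_def)
    then have d_eq: "d M act = d N act'"
      using d[OF M] d[OF N] idx by (auto simp: tw_def bij_betw_def inj_on_eq_iff)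
    obtain g h where
      "twisted_hom (d M act) (fst (R (\<kappa> M act))) (snd (R (\<kappa> M act))) M act g"
      "twisted_hom (d M act) (fst (R (\<kappa> M act))) (snd (R (\<kappa> M act))) N act' h"
      using d[OF M] d[OF N] unfolding tw_def \<kappa>_eq d_eq by blast
    then show ?thesis
      by (rule twisted_homs_imp_iso[OF R(1)[OF M] M N])
  qed
  show ?thesis
    unfolding C_def[symmetric] by (rule at_most_simplesI[OF less iso])
qed

text \<open>Bounds the number of twists: a power c^p vanishes only for c = 0, and otherwise c is a
  root of a nonzero polynomial of degree at most p.\<close>

lemma card_frobenius_eigenvalues:
  fixes \<epsilon> :: "'f::field"
  assumes "p > 1" "\<epsilon> \<in> {0, 1}"
  shows "finite {c. c ^ p = \<epsilon> * c}" "card {c. c ^ p = \<epsilon> * c} \<le> (if \<epsilon> = 0 then 1 else p)"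
proof -
  define q where "q = monom 1 p - [:0, \<epsilon>:]"
  have coeff_q: "coeff q i = (if i = p then 1 else 0) - (if i = 1 then \<epsilon> else 0)" for i
    by (auto simp: q_def coeff_pCons split: nat.split)
  have "coeff q p = 1"
    using assms(1) by (simp add: coeff_q)
  then have "q \<noteq> 0"
    by auto
  moreover have "degree q \<le> p"
    using assms(1) by (auto simp: coeff_q intro!: degree_le)
  ultimately have q: "degree q \<le> p" "q \<noteq> 0"
    by auto
  have eq: "{c. c ^ p = \<epsilon> * c} = {c. poly q c = 0}"
    by (auto simp: q_def poly_monom mult.commute)
  show "finite {c. c ^ p = \<epsilon> * c}"
    unfolding eq by (rule poly_roots_finite[OF q(2)])
  show "card {c. c ^ p = \<epsilon> * c} \<le> (if \<epsilon> = 0 then 1 else p)"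
  proof (cases "\<epsilon> = 0")
    case True
    then have "{c. c ^ p = \<epsilon> * c} = {0}"
      using assms(1) by auto
    then show ?thesis
      using True by simp
  next
    case False
    then show ?thesis
      using card_poly_roots_bound[OF q(2)] q(1) by (simp add: eq)
  qed
qed

section \<open>The number of simple modules\<close>

locale solvable_restricted_lie_algebra_rep =
  restricted_lie_algebra_rep scale bracket p pmap scaleV +
  L: solvable_restricted_lie_algebra scale bracket p pmap Basis
  for scale :: "'f::alg_closed_field \<Rightarrow> 'l::ab_group_add \<Rightarrow> 'l"
    and bracket :: "'l \<Rightarrow> 'l \<Rightarrow> 'l"
    and p :: nat
    and pmap :: "'l \<Rightarrow> 'l"
    and scaleV :: "'f \<Rightarrow> 'v::ab_group_add \<Rightarrow> 'v"
    and Basis :: "'l set"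
begin

text \<open>Induction on the dimension along the ideals of codimension one. Existence of simple
  submodules is carried along because the counting step chooses one over \<open>K\<close>;
  \<open>T\<close> gains a toral element exactly when the bound gains a factor p.\<close>

lemma simples_of_p_subalgebra:
  assumes "L.p_subalgebra H"
  shows "has_simple_submodules \<chi> H \<and>
    (\<exists>T. L.toral_set T \<and> T \<subseteq> H \<and> at_most_simples \<chi> H (p ^ card T))"
  using assms
proof (induction "L.dim H" arbitrary: H rule: less_induct)
  case less
  show ?case
  proof (cases "H = {0}")
    case True
    have "L.toral_set {}"
      by (simp add: L.toral_set_def L.independent_empty)
    then show ?thesis
      using trivial_algebra True by (auto intro!: exI[of _ "{}"])
  next
    case False
    obtain K z \<epsilon> where K: "L.p_subalgebra K" "K \<subseteq> H" and z: "z \<in> H" "z \<notin> K" and \<epsilon>: "\<epsilon> \<in> {0, 1}"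
      and pz: "pmap z - scale \<epsilon> z \<in> K" and br: "\<And>x y. x \<in> H \<Longrightarrow> y \<in> H \<Longrightarrow> bracket x y \<in> K"
      and dec: "\<And>x. x \<in> H \<Longrightarrow> \<exists>a. x - scale a z \<in> K"
      using L.ex_p_ideal_codim_1[OF less.prems False] by metis
    interpret ideal: codim_1_ideal scale bracket p pmap scaleV \<chi> H K z \<epsilon>
      by unfold_locales (use less.prems K z pz br dec in auto)
    have "L.subspace H" "L.subspace K"
      using less.prems K by (auto simp: L.p_subalgebra_def)
    then have "L.dim K < L.dim H"
      using K(2) z by (intro L.dim_psubset) (auto simp: L.span_eq_iff[THEN iffD2])
    then obtain T where subK: "has_simple_submodules \<chi> K"
      and T: "L.toral_set T" "T \<subseteq> K" "at_most_simples \<chi> K (p ^ card T)"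
      using less.hyps K(1) by blast
    have "has_simple_submodules \<chi> H"
      using ideal.ex_simple_submodule_extend subK unfolding has_simple_submodules_def by blast
    moreover have "at_most_simples \<chi> H (p ^ card T * (if \<epsilon> = 0 then 1 else p))"
      using ideal.at_most_simples_extend[OF subK T(3)] card_frobenius_eigenvalues[OF L.p_gt_1 \<epsilon>]
      by (auto intro: at_most_simples_mono)
    moreover have "\<exists>T'. L.toral_set T' \<and> T' \<subseteq> H \<and> p ^ card T' = p ^ card T * (if \<epsilon> = 0 then 1 else p)"
    proof (cases "\<epsilon> = 0")
      case True
      then show ?thesis
        using T K(2) by auto
    next
      case False
      then have "pmap z - z \<in> K"
        using \<epsilon> pz by simp
      then obtain t where t: "t \<in> H" "t \<notin> K" "pmap t = t" "\<And>s. s \<in> T \<Longrightarrow> bracket s t = 0"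
        using L.ex_toral_outside[OF less.prems K br z _ T(1,2)] by blast
      have "t \<notin> L.span T"
        using t(2) L.span_minimal[OF T(2) \<open>L.subspace K\<close>] by blast
      then have "L.independent (insert t T)"
        using T(1) by (intro L.independent_insertI) (auto simp: L.toral_set_def)
      moreover have "bracket t s = 0" if "s \<in> T" for s
        using t(4)[OF that] L.bracket_anti[of t s] by simp
      ultimately have "L.toral_set (insert t T)"
        using T(1) t(3,4) by (auto simp: L.toral_set_def L.bracket_self)
      moreover have "card (insert t T) = Suc (card T)"
        using T(1,2) t(2) by (subst card_insert_disjoint) (auto simp: L.toral_set_def)
      ultimately show ?thesis
        using False t(1) T(2) K(2) by (intro exI[of _ "insert t T"]) auto
    qed
    ultimately show ?thesis
      by metis
  qed
qed

lemma irreducible_modules_simple: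
  assumes "(M, act) \<in> irreducible_modules \<chi>"
  shows "simple \<chi> UNIV M act"
proof -
  have lm: "lie_module M act" and nz: "M \<noteq> {0}" and pc: "has_p_character M act \<chi>"
    and irr: "\<And>N. N \<subseteq> M \<Longrightarrow> lie_module N act \<Longrightarrow> N = {0} \<or> N = M"
    using assms by (auto simp: irreducible_modules_def irreducible_module_def)
  have "chi_module \<chi> UNIV M act"
    using lm pc unfolding chi_module_def lie_module_def has_p_character_def by simp
  moreover have "lie_module N act" if "N \<subseteq> M" "stable UNIV N act" for N
    using lm that unfolding lie_module_def stable_def by (simp add: subset_iff)
  ultimately show ?thesis
    using irr nz unfolding simple_def by blast
qed

lemma lie_iso_imp_isomorphic: "lie_iso UNIV M act N act' \<Longrightarrow> isomorphic (M, act) (N, act')"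
  unfolding lie_iso_def lie_hom_def isomorphic_def by auto

text \<open>The numbering of simple modules passes to isomorphism classes through chosen
  representatives and is injective there. The toral set in the exponent is bounded by
  \<open>MT\<close>, since it spans a torus.\<close>

lemma card_irreducible_classes:
  "finite (irreducible_classes \<chi>) \<and> card (irreducible_classes \<chi>) \<le> p ^ L.MT"
proof -
  have "L.p_subalgebra UNIV"
    by (simp add: L.p_subalgebra_def L.subspace_UNIV)
  then obtain T where T: "L.toral_set T" "at_most_simples \<chi> UNIV (p ^ card T)"
    using simples_of_p_subalgebra by blast
  obtain code where code: "\<forall>M act. simple \<chi> UNIV M act \<longrightarrow> code M act < p ^ card T"
    and code_iso: "\<forall>M act N act'. simple \<chi> UNIV M act \<longrightarrow> simple \<chi> UNIV N act' \<longrightarrow> code M act = code N act' \<longrightarrow>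
      lie_iso UNIV M act N act'"
    by (rule at_most_simplesE[OF T(2)])
  define f where "f Q = (let X = (SOME X. X \<in> Q) in code (fst X) (snd X))" for Q
  have rep: "\<exists>X\<in>irreducible_modules \<chi>. Q = iso_rel \<chi> `` {X} \<and> f Q = code (fst X) (snd X)"
    if Q: "Q \<in> irreducible_classes \<chi>" for Q
  proof -
    obtain Y where Y: "Y \<in> irreducible_modules \<chi>" "Q = iso_rel \<chi> `` {Y}"
      using Q unfolding irreducible_classes_def by (rule quotientE)
    have "Y \<in> Q"
      unfolding Y(2) by (rule equiv_class_self[OF equiv_iso_rel Y(1)])
    then have X: "(SOME X. X \<in> Q) \<in> Q"
      by (rule someI)
    then have YX: "(Y, SOME X. X \<in> Q) \<in> iso_rel \<chi>"
      unfolding Y(2) by blast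
    then have "(SOME X. X \<in> Q) \<in> irreducible_modules \<chi>"
      by (simp add: iso_rel_def)
    moreover have "Q = iso_rel \<chi> `` {SOME X. X \<in> Q}"
      by (rule trans[OF Y(2) equiv_class_eq[OF equiv_iso_rel YX]])
    ultimately show ?thesis
      unfolding f_def Let_def by blast
  qed
  have "f Q < p ^ card T" if Q: "Q \<in> irreducible_classes \<chi>" for Q
  proof -
    obtain X where X: "X \<in> irreducible_modules \<chi>" "f Q = code (fst X) (snd X)"
      using rep[OF Q] by blast
    have "simple \<chi> UNIV (fst X) (snd X)"
      using X(1) by (simp add: irreducible_modules_simple)
    then show ?thesis
      using code X(2) by simp
  qed
  then have range: "f ` irreducible_classes \<chi> \<subseteq> {..<p ^ card T}"
    by auto
  have inj: "inj_on f (irreducible_classes \<chi>)"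
  proof (rule inj_onI)
    fix P Q assume P: "P \<in> irreducible_classes \<chi>" and Q: "Q \<in> irreducible_classes \<chi>" and eq: "f P = f Q"
    obtain X where X: "X \<in> irreducible_modules \<chi>" "P = iso_rel \<chi> `` {X}" "f P = code (fst X) (snd X)"
      using rep[OF P] by blast
    obtain Y where Y: "Y \<in> irreducible_modules \<chi>" "Q = iso_rel \<chi> `` {Y}" "f Q = code (fst Y) (snd Y)"
      using rep[OF Q] by blast
    have "simple \<chi> UNIV (fst X) (snd X)" "simple \<chi> UNIV (fst Y) (snd Y)"
      using X(1) Y(1) by (simp_all add: irreducible_modules_simple)
    then have "lie_iso UNIV (fst X) (snd X) (fst Y) (snd Y)"
      using X(3) Y(3) eq code_iso by simp
    then have "isomorphic (fst X, snd X) (fst Y, snd Y)"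
      by (rule lie_iso_imp_isomorphic)
    then have "(X, Y) \<in> iso_rel \<chi>"
      using X(1) Y(1) by (simp add: iso_rel_def)
    then show "P = Q"
      unfolding X(2) Y(2) by (rule equiv_class_eq[OF equiv_iso_rel])
  qed
  have "card (irreducible_classes \<chi>) \<le> p ^ card T"
    using card_inj_on_le[OF inj range] by simp
  also have "\<dots> \<le> p ^ L.MT"
    using L.card_toral_set_le_MT[OF T(1)] L.p_gt_1 by (intro power_increasing) auto
  finally show ?thesis
    using inj_on_finite[OF inj range] by simp
qed

end

theorem theorem3p1:
  fixes scale :: "'f::alg_closed_field \<Rightarrow> 'l::ab_group_add \<Rightarrow> 'l"
    and bracket :: "'l \<Rightarrow> 'l \<Rightarrow> 'l"
    and p :: nat
    and pmap :: "'l \<Rightarrow> 'l"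
    and B :: "'l set"
    and scaleV :: "'f \<Rightarrow> 'v::ab_group_add \<Rightarrow> 'v"
    and \<chi> :: "'l \<Rightarrow> 'f"
  assumes "restricted_lie_algebra scale bracket p pmap"
    and "finite_dimensional_vector_space scale B"
    and "lie_algebra.solvable scale bracket"
    and "vector_space scaleV"
    and "Vector_Spaces.linear scale (*) \<chi>"
  shows "finite (restricted_lie_algebra_rep.irreducible_classes scale bracket p pmap scaleV \<chi>) \<and>
    card (restricted_lie_algebra_rep.irreducible_classes scale bracket p pmap scaleV \<chi>)
      \<le> p ^ restricted_lie_algebra.MT scale bracket pmap"
proof -
  interpret solvable_restricted_lie_algebra_rep scale bracket p pmap scaleV B
    using assms(1-4)
    by (simp add: solvable_restricted_lie_algebra_rep_def restricted_lie_algebra_rep_def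
        solvable_restricted_lie_algebra_def solvable_restricted_lie_algebra_axioms_def)
  show ?thesis
    by (rule card_irreducible_classes)
qed

end
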